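(* Let $q\ge 2$ be an integer. Then the operators $\Gamma_q[f]$, $f\in L^\infty(\mathbb{T})$, are simultaneously unitarily equivalent to the direct sum of countably infinitely many copies of the standard Toeplitz operator $T(f)=\Gamma_1[f]$. That is, there exists a unitary operator $U:\ell^2(T_q)\to\bigoplus_{k=1}^\infty\ell^2(\mathbb{N})$ such that for all $f\in L^\infty(\mathbb{T})$, $$\Gamma_q[f]=U^{-1}\Big(\bigoplus_{k=1}^\infty T(f)\Big)U.$$
   Context: $T_q$ denotes the (vertex set of the) infinite rooted $q$-homogeneous tree: there is a root $o$, and each vertex has exactly $q$ children. $d$ is the graph distance and $|\sigma| := d(o,\sigma)$. Write $\sigma_1\preccurlyeq\sigma_2$ if $\sigma_1,\sigma_2$ lie on a common geodesic ray starting at the root and $|\sigma_1|\le|\sigma_2|$. Let $\mathcal{C}\subset T_q\times T_q$ be the set of comparable pairs ($\sigma_1\preccurlyeq\sigma_2$ or $\sigma_2\preccurlyeq\sigma_1$), with indicator function $\mathbf{1}_{\mathcal{C}}$. $\mathbb{T}=\mathbb{R}/2\pi\mathbb{Z}$, $\mathbb{N}=\{0,1,2,\dots\}$. For $f\in L^\infty(\mathbb{T})$, $\widehat f(n)=\int_{\mathbb{T}} f(e^{i\theta})e^{-in\theta}\frac{d\theta}{2\pi}$, and $$\Gamma_q[f](\sigma_1,\sigma_2) := q^{-d(\sigma_1,\sigma_2)/2}\,\widehat f(|\sigma_1|-|\sigma_2|)\,\mathbf{1}_{\mathcal{C}}(\sigma_1,\sigma_2).$$ Bounded operators $A$ on $\ell^2(T_q)$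 are identified with their kernels $A(\sigma_1,\sigma_2)=\langle A\delta_{\sigma_2},\delta_{\sigma_1}\rangle$; for every $f\in L^\infty(\mathbb{T})$ the kernel $\Gamma_q[f]$ represents a bounded operator on $\ell^2(T_q)$. $T(f)=\Gamma_1[f]$ is the bounded operator on $\ell^2(\mathbb{N})$ with matrix $[\widehat f(k-l)]_{k,l\in\mathbb{N}}$. *)

theory Defs
  imports "HOL-Analysis.Analysis"
begin

section \<open>The rooted homogeneous tree\<close>

text \<open>A vertex is the list of child indices met on the way down from the root \<^term>\<open>[]\<close>;
  the children of \<open>\<sigma>\<close> are \<open>\<sigma> @ [i]\<close> with \<open>i < q\<close>.\<close>

definition tree :: "nat \<Rightarrow> nat list set" where
  "tree q = {\<sigma>. set \<sigma> \<subseteq> {..<q}}"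

definition tree_adj :: "nat \<Rightarrow> nat list \<Rightarrow> nat list \<Rightarrow> bool" where
  "tree_adj q \<sigma> \<tau> \<longleftrightarrow> \<sigma> \<in> tree q \<and> \<tau> \<in> tree q \<and> (\<exists>i. \<tau> = \<sigma> @ [i] \<or> \<sigma> = \<tau> @ [i])"

definition tree_dist :: "nat \<Rightarrow> nat list \<Rightarrow> nat list \<Rightarrow> nat" where
  "tree_dist q \<sigma> \<tau> = (LEAST n. (tree_adj q ^^ n) \<sigma> \<tau>)"

definition level :: "nat \<Rightarrow> nat list \<Rightarrow> nat" where
  "level q \<sigma> = tree_dist q [] \<sigma>"

definition root_ray :: "nat \<Rightarrow> (nat \<Rightarrow> nat list) \<Rightarrow> bool" where
  "root_ray q \<gamma> \<longleftrightarrow> \<gamma> 0 = [] \<and> (\<forall>n. \<gamma> n \<in> tree q) \<and>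
     (\<forall>m n. m \<le> n \<longrightarrow> tree_dist q (\<gamma> m) (\<gamma> n) = n - m)"

definition below :: "nat \<Rightarrow> nat list \<Rightarrow> nat list \<Rightarrow> bool" where
  "below q \<sigma> \<tau> \<longleftrightarrow>
     (\<exists>\<gamma>. root_ray q \<gamma> \<and> \<sigma> \<in> range \<gamma> \<and> \<tau> \<in> range \<gamma>) \<and> level q \<sigma> \<le> level q \<tau>"

definition comparable :: "nat \<Rightarrow> (nat list \<times> nat list) set" where
  "comparable q = {(\<sigma>, \<tau>). \<sigma> \<in> tree q \<and> \<tau> \<in> tree q \<and> (below q \<sigma> \<tau> \<or> below q \<tau> \<sigma>)}"


section \<open>Bounded symbols on the circle\<close>

text \<open>Elements of \<open>L\<^sup>\<infinity>(\<T>)\<close> are represented by functions on \<open>\<complex>\<close>, of which only the values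
  on the unit circle matter; functions that agree almost everywhere there have the same
  Fourier coefficients.\<close>

definition L_infinity_circle :: "(complex \<Rightarrow> complex) set" where
  "L_infinity_circle = {f. (\<lambda>\<theta>. f (cis \<theta>)) \<in> borel_measurable (lebesgue_on {0..2*pi}) \<and>
     (\<exists>C. AE \<theta> in lebesgue_on {0..2*pi}. cmod (f (cis \<theta>)) \<le> C)}"

definition fourier_coeff :: "(complex \<Rightarrow> complex) \<Rightarrow> int \<Rightarrow> complex" where
  "fourier_coeff f n =
     (\<integral>\<theta>. f (cis \<theta>) * cis (- (of_int n * \<theta>)) \<partial>lebesgue_on {0..2*pi}) / of_real (2*pi)"

definition Gamma_kernel ::
  "nat \<Rightarrow> (complex \<Rightarrow> complex) \<Rightarrow> nat list \<Rightarrow> nat list \<Rightarrow> complex" where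
  "Gamma_kernel q f \<sigma> \<tau> = of_real (real q powr (- (real (tree_dist q \<sigma> \<tau>) / 2))) *
     fourier_coeff f (int (level q \<sigma>) - int (level q \<tau>)) * indicator (comparable q) (\<sigma>, \<tau>)"

definition Toeplitz_kernel :: "(complex \<Rightarrow> complex) \<Rightarrow> nat \<Rightarrow> nat \<Rightarrow> complex" where
  "Toeplitz_kernel f k l = fourier_coeff f (int k - int l)"


section \<open>The Hilbert spaces and their operators\<close>

text \<open>\<open>\<ell>\<^sup>2(S)\<close> consists of functions on the whole type that vanish outside \<open>S\<close>.\<close>

definition ell2 :: "'a set \<Rightarrow> ('a \<Rightarrow> complex) set" where
  "ell2 S = {x. (\<forall>s. s \<notin> S \<longrightarrow> x s = 0) \<and> (\<lambda>s. (cmod (x s))\<^sup>2) summable_on S}"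

definition ell2_inner :: "'a set \<Rightarrow> ('a \<Rightarrow> complex) \<Rightarrow> ('a \<Rightarrow> complex) \<Rightarrow> complex" where
  "ell2_inner S x y = (\<Sum>\<^sub>\<infinity>s\<in>S. x s * cnj (y s))"

definition ell2_norm :: "'a set \<Rightarrow> ('a \<Rightarrow> complex) \<Rightarrow> real" where
  "ell2_norm S x = sqrt (\<Sum>\<^sub>\<infinity>s\<in>S. (cmod (x s))\<^sup>2)"

definition delta :: "'a \<Rightarrow> 'a \<Rightarrow> complex" where
  "delta t = (\<lambda>s. if s = t then 1 else 0)"

definition bounded_operator :: "'a set \<Rightarrow> (('a \<Rightarrow> complex) \<Rightarrow> 'a \<Rightarrow> complex) \<Rightarrow> bool" where
  "bounded_operator S A \<longleftrightarrow> A \<in> ell2 S \<rightarrow> ell2 S \<and>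
     (\<forall>x\<in>ell2 S. \<forall>y\<in>ell2 S. \<forall>a b.
        A (\<lambda>s. a * x s + b * y s) = (\<lambda>s. a * A x s + b * A y s)) \<and>
     (\<exists>C. \<forall>x\<in>ell2 S. ell2_norm S (A x) \<le> C * ell2_norm S x)"

text \<open>A bounded operator is determined by its kernel on \<^term>\<open>ell2 S\<close>; requiring it to be
  \<^const>\<open>extensional\<close> makes it unique as a HOL function. The description is only meaningful
  for kernels that represent a bounded operator.\<close>

definition operator_of_kernel ::
  "'a set \<Rightarrow> ('a \<Rightarrow> 'a \<Rightarrow> complex) \<Rightarrow> ('a \<Rightarrow> complex) \<Rightarrow> 'a \<Rightarrow> complex" where
  "operator_of_kernel S K = (THE A. bounded_operator S A \<and> A \<in> extensional (ell2 S) \<and>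
     (\<forall>s\<in>S. \<forall>t\<in>S. ell2_inner S (A (delta t)) (delta s) = K s t))"

definition Gamma_operator ::
  "nat \<Rightarrow> (complex \<Rightarrow> complex) \<Rightarrow> (nat list \<Rightarrow> complex) \<Rightarrow> nat list \<Rightarrow> complex" where
  "Gamma_operator q f = operator_of_kernel (tree q) (Gamma_kernel q f)"

definition Toeplitz_operator :: "(complex \<Rightarrow> complex) \<Rightarrow> (nat \<Rightarrow> complex) \<Rightarrow> nat \<Rightarrow> complex" where
  "Toeplitz_operator f = operator_of_kernel UNIV (Toeplitz_kernel f)"

text \<open>The Hilbert space direct sum of copies of \<open>\<ell>\<^sup>2(\<nat>)\<close>, one for each natural number.\<close>

definition direct_sum :: "(nat \<Rightarrow> nat \<Rightarrow> complex) set" where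
  "direct_sum = {v. (\<forall>k. v k \<in> ell2 UNIV) \<and> (\<lambda>k. (ell2_norm UNIV (v k))\<^sup>2) summable_on UNIV}"

definition direct_sum_inner ::
  "(nat \<Rightarrow> nat \<Rightarrow> complex) \<Rightarrow> (nat \<Rightarrow> nat \<Rightarrow> complex) \<Rightarrow> complex" where
  "direct_sum_inner v w = (\<Sum>\<^sub>\<infinity>k. ell2_inner UNIV (v k) (w k))"

definition direct_sum_op :: "(nat \<Rightarrow> (nat \<Rightarrow> complex) \<Rightarrow> nat \<Rightarrow> complex) \<Rightarrow>
    (nat \<Rightarrow> nat \<Rightarrow> complex) \<Rightarrow> nat \<Rightarrow> nat \<Rightarrow> complex" where
  "direct_sum_op A v = (\<lambda>k. A k (v k))"

definition unitary_to_direct_sum ::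
  "'a set \<Rightarrow> (('a \<Rightarrow> complex) \<Rightarrow> nat \<Rightarrow> nat \<Rightarrow> complex) \<Rightarrow> bool" where
  "unitary_to_direct_sum S U \<longleftrightarrow> bij_betw U (ell2 S) direct_sum \<and>
     (\<forall>x\<in>ell2 S. \<forall>y\<in>ell2 S. \<forall>a b.
        U (\<lambda>s. a * x s + b * y s) = (\<lambda>k n. a * U x k n + b * U y k n)) \<and>
     (\<forall>x\<in>ell2 S. \<forall>y\<in>ell2 S. direct_sum_inner (U x) (U y) = ell2_inner S x y)"


section \<open>The case of one child\<close>

lemma tree_dist_append:
  assumes "\<sigma> @ \<rho> \<in> tree q"
  shows "tree_dist q \<sigma> (\<sigma> @ \<rho>) = length \<rho>"
  unfolding tree_dist_def
proof (rule Least_equality)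
  show "(tree_adj q ^^ length \<rho>) \<sigma> (\<sigma> @ \<rho>)"
    using assms
  proof (induction \<rho> rule: rev_induct)
    case (snoc i \<rho>)
    then have "\<sigma> @ \<rho> \<in> tree q" "tree_adj q (\<sigma> @ \<rho>) (\<sigma> @ \<rho> @ [i])"
      by (auto simp: tree_def tree_adj_def)
    with snoc.IH show ?case by auto
  qed simp
  have walk: "length \<tau> \<le> length \<sigma> + n" if "(tree_adj q ^^ n) \<sigma> \<tau>" for n \<tau>
    using that
  proof (induction n arbitrary: \<tau>)
    case (Suc n)
    then obtain \<upsilon> where "(tree_adj q ^^ n) \<sigma> \<upsilon>" "tree_adj q \<upsilon> \<tau>" by auto
    moreover from this have "length \<tau> \<le> Suc (length \<upsilon>)" by (auto simp: tree_adj_def)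
    ultimately show ?case using Suc.IH[of \<upsilon>] by simp
  qed simp
  show "length \<rho> \<le> n" if "(tree_adj q ^^ n) \<sigma> (\<sigma> @ \<rho>)" for n
    using walk[OF that] by simp
qed

text \<open>Identifying \<open>\<nat>\<close> with the vertices of \<^term>\<open>tree 1\<close>, the Toeplitz kernel is
  \<open>Gamma_kernel 1\<close>.\<close>

lemma tree_1: "tree 1 = range (\<lambda>k. replicate k 0)"
proof -
  have "\<sigma> = replicate (length \<sigma>) 0" if "\<sigma> \<in> tree 1" for \<sigma>
    using that by (intro replicate_eqI) (auto simp: tree_def)
  then show ?thesis by (auto simp: tree_def)
qed

lemma Gamma_kernel_1:
  "Gamma_kernel 1 f (replicate k 0) (replicate l 0) = Toeplitz_kernel f k l"
proof -
  have vertex: "replicate n 0 \<in> tree 1" for n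
    unfolding tree_1 by blast
  have dist: "tree_dist 1 (replicate m 0) (replicate n 0) = n - m" if "m \<le> n" for m n
    using tree_dist_append[of "replicate m 0" "replicate (n - m) 0" 1] vertex that
    by (simp flip: replicate_add)
  have level: "level 1 (replicate n 0) = n" for n
    using dist[of 0 n] by (simp add: level_def)
  have ray: "root_ray 1 (\<lambda>n. replicate n 0)"
    using dist vertex by (simp add: root_ray_def)
  have "below 1 (replicate m 0) (replicate n 0)" if "m \<le> n" for m n
    unfolding below_def level using ray that by blast
  then have "(replicate k 0, replicate l 0) \<in> comparable 1"
    using vertex linear[of k l] unfolding comparable_def by blast
  then show ?thesis
    by (simp add: Gamma_kernel_def Toeplitz_kernel_def level[unfolded One_nat_def])
qed

end

theory Submission
  imports Defs
begin

text \<open>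
  Let \<open>S\<close> be the isometry of \<open>\<ell>\<^sup>2\<close> of the tree that divides the value at a vertex by \<open>\<surd>q\<close> and copies
  it to all the children. The matrix of \<open>S ^^ n\<close> has the entry \<open>q\<close> to the power \<open>- n / 2\<close> at each
  pair formed by a vertex and its ancestor \<open>n\<close> levels above, so between the levels \<open>s\<close> and \<open>t\<close> the
  kernel \<open>\<Gamma>\<^sub>q[f]\<close> is the Fourier coefficient of \<open>f\<close> at \<open>s - t\<close> times a power of \<open>S\<close> (if \<open>s \<ge> t\<close>) or of
  its adjoint (if \<open>s \<le> t\<close>); this is \<open>Gamma_kernel_eq_shift\<close>. In the same way \<open>T(f)\<close> is built from the
  unilateral shift on \<open>\<ell>\<^sup>2(\<nat>)\<close>. The theorem is therefore the Wold decomposition of \<open>S\<close>: an isometry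
  without unitary part is a direct sum of unilateral shifts, as many as the dimension of the kernel
  of its adjoint, and here that kernel is infinite-dimensional because \<open>q \<ge> 2\<close>.

  The decomposition is given by an explicit orthonormal basis. The kernel of the adjoint
  consists of the functions that sum to zero over the children of every vertex, with arbitrary value
  at the root. The nonconstant characters of the cyclic group of order \<open>q\<close>, placed on the children of
  the vertices, together with the point mass at the root, form an orthonormal basis of it, indexed by
  the words \<open>b\<close> that do not end in \<open>0\<close>. Appending \<open>n\<close> zeros to \<open>b\<close> labels the image of its basis vector
  under \<open>S ^^ n\<close>, and in this way every vertex labels exactly one vector (\<open>bij_word\<close>). The basis vector
  of a word is supported on the level of that word, so orthonormality and completeness are statements
  about finite-dimensional spaces, proved by induction on the level (\<open>wold_parseval\<close>, \<open>wold_unwold\<close>).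

  There remain two analytic points. The operators in the statement are described by their kernels, so
  boundedness of \<open>T(f)\<close> is shown first, from uniform bounds for finite sections
  (\<open>toeplitz_finite_sections\<close>). The operator \<open>U\<^sup>-\<^sup>1 (\<Oplus> T(f)) U\<close> is then bounded, and
  as a bounded operator is determined by its kernel (\<open>operator_of_kernel_eq\<close>), only the kernel needs
  to be compared with \<open>\<Gamma>\<^sub>q[f]\<close> (\<open>wold_conjugate_kernel\<close>).
\<close>

section \<open>The tree and the kernel\<close>

lemma tree_snoc [simp]: "\<sigma> @ [i] \<in> tree q \<longleftrightarrow> \<sigma> \<in> tree q \<and> i < q"
  by (auto simp: tree_def)

lemma tree_append: "\<sigma> @ \<rho> \<in> tree q \<longleftrightarrow> \<sigma> \<in> tree q \<and> \<rho> \<in> tree q"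
  by (auto simp: tree_def)

lemma tree_Nil [simp]: "[] \<in> tree q"
  by (simp add: tree_def)

lemma replicate_0_in_tree: "0 < q \<Longrightarrow> replicate n 0 \<in> tree q"
  by (auto simp: tree_def)

lemma take_in_tree: "\<sigma> \<in> tree q \<Longrightarrow> take n \<sigma> \<in> tree q"
  by (auto simp: tree_def dest: in_set_takeD)

lemma level_eq_length:
  assumes "\<sigma> \<in> tree q"
  shows "level q \<sigma> = length \<sigma>"
  using tree_dist_append[of "[]" \<sigma> q] assms by (simp add: level_def)

lemma tree_walk_from_root:
  assumes "\<sigma> \<in> tree q"
  shows "(tree_adj q)\<^sup>*\<^sup>* [] \<sigma>"
  using assms
proof (induction \<sigma> rule: rev_induct)
  case (snoc i \<sigma>)
  then have "tree_adj q \<sigma> (\<sigma> @ [i])"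
    by (auto simp: tree_adj_def)
  with snoc show ?case
    by (auto intro: rtranclp.rtrancl_into_rtrancl)
qed simp

lemma tree_connected:
  assumes "\<sigma> \<in> tree q" "\<tau> \<in> tree q"
  shows "(tree_adj q)\<^sup>*\<^sup>* \<sigma> \<tau>"
proof -
  have "symp (tree_adj q)"
    by (auto simp: symp_def tree_adj_def)
  then have "(tree_adj q)\<^sup>*\<^sup>* \<sigma> []"
    using symp_rtranclp tree_walk_from_root[OF assms(1)] sympD by fast
  then show ?thesis
    using tree_walk_from_root[OF assms(2)] by (rule rtranclp_trans)
qed

text \<open>The distance is a least walk length, so it says something about walks only between vertices
  joined by some walk; connectedness provides one.\<close>

lemma tree_dist_1_imp_adj:
  assumes "\<sigma> \<in> tree q" "\<tau> \<in> tree q" "tree_dist q \<sigma> \<tau> = 1"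
  shows "tree_adj q \<sigma> \<tau>"
proof -
  obtain n where "(tree_adj q ^^ n) \<sigma> \<tau>"
    using tree_connected[OF assms(1,2)] by (auto simp: rtranclp_power)
  then have "(tree_adj q ^^ tree_dist q \<sigma> \<tau>) \<sigma> \<tau>"
    unfolding tree_dist_def by (rule LeastI)
  then show ?thesis
    by (simp only: assms(3) relpowp_1)
qed

text \<open>Consecutive vertices of a geodesic ray from the root are adjacent and lie on levels \<open>n\<close> and
  \<open>n + 1\<close>, so each step of the ray goes to a child.\<close>

lemma root_ray_prefix:
  assumes "root_ray q \<gamma>" "m \<le> n"
  shows "\<exists>\<rho>. \<gamma> n = \<gamma> m @ \<rho>"
  using assms(2)
proof (induction n rule: dec_induct)
  case base
  show ?case by simp
next
  case (step n)
  have tree: "\<gamma> k \<in> tree q" for k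
    using assms(1) unfolding root_ray_def by blast
  have len: "length (\<gamma> k) = k" for k
  proof -
    have "\<gamma> 0 = []" "tree_dist q (\<gamma> 0) (\<gamma> k) = k - 0"
      using assms(1) unfolding root_ray_def by blast+
    then show ?thesis
      using level_eq_length[OF tree, of k] by (simp add: level_def)
  qed
  have "tree_dist q (\<gamma> n) (\<gamma> (Suc n)) = Suc n - n"
    using assms(1) unfolding root_ray_def by (meson le_SucI order_refl)
  then have "tree_adj q (\<gamma> n) (\<gamma> (Suc n))"
    by (intro tree_dist_1_imp_adj tree) simp
  then obtain i where "\<gamma> (Suc n) = \<gamma> n @ [i] \<or> \<gamma> n = \<gamma> (Suc n) @ [i]"
    by (auto simp: tree_adj_def)
  moreover have "\<gamma> n \<noteq> \<gamma> (Suc n) @ [i]"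
    using len[of n] len[of "Suc n"] by (metis length_append_singleton n_not_Suc_n Suc_n_not_le_n le_SucI order_refl)
  ultimately show ?case
    using step.IH by auto
qed

text \<open>Descending to \<open>\<tau>\<close> and continuing forever into the children with index \<open>0\<close> is a geodesic ray.\<close>

lemma root_ray_through:
  assumes "0 < q" "\<tau> \<in> tree q"
  shows "root_ray q (\<lambda>n. take n (\<tau> @ replicate n 0))"
proof -
  define \<gamma> where "\<gamma> = (\<lambda>n. take n (\<tau> @ replicate n 0))"
  have tree: "\<gamma> n \<in> tree q" for n
    unfolding \<gamma>_def using assms by (intro take_in_tree) (simp add: tree_append replicate_0_in_tree)
  have len: "length (\<gamma> n) = n" for n
    by (simp add: \<gamma>_def)
  have pre: "take m (\<gamma> n) = \<gamma> m" if "m \<le> n" for m n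
    using that by (simp add: \<gamma>_def min_def)
  have "tree_dist q (\<gamma> m) (\<gamma> n) = n - m" if "m \<le> n" for m n
  proof -
    have "\<gamma> n = \<gamma> m @ drop m (\<gamma> n)"
      using append_take_drop_id[of m "\<gamma> n"] pre[OF that] by simp
    then show ?thesis
      using tree_dist_append[of "\<gamma> m" "drop m (\<gamma> n)" q] tree[of n] by (simp add: len)
  qed
  then have "root_ray q \<gamma>"
    using tree len[of 0] by (simp add: root_ray_def)
  then show ?thesis
    by (simp add: \<gamma>_def)
qed

text \<open>The order defined by geodesic rays is the prefix order on words, which makes the kernel of
  \<open>\<Gamma>\<^sub>q[f]\<close> computable.\<close>

lemma below_iff_prefix:
  assumes "0 < q" "\<sigma> \<in> tree q" "\<tau> \<in> tree q"
  shows "below q \<sigma> \<tau> \<longleftrightarrow> (\<exists>\<rho>. \<tau> = \<sigma> @ \<rho>)"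
proof
  assume "below q \<sigma> \<tau>"
  then obtain \<gamma> m n where ray: "root_ray q \<gamma>" "\<sigma> = \<gamma> m" "\<tau> = \<gamma> n"
    and le: "length \<sigma> \<le> length \<tau>"
    using assms by (auto simp: below_def level_eq_length)
  show "\<exists>\<rho>. \<tau> = \<sigma> @ \<rho>"
  proof (cases "m \<le> n")
    case True
    then show ?thesis using root_ray_prefix[OF ray(1)] ray(2,3) by simp
  next
    case False
    then obtain \<rho> where "\<sigma> = \<tau> @ \<rho>"
      using root_ray_prefix[of q \<gamma> n m] ray by auto
    with le show ?thesis by simp
  qed
next
  assume "\<exists>\<rho>. \<tau> = \<sigma> @ \<rho>"
  then obtain \<rho> where \<rho>: "\<tau> = \<sigma> @ \<rho>" ..
  let ?\<gamma> = "\<lambda>n. take n (\<tau> @ replicate n 0)"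
  have "?\<gamma> (length \<sigma>) = \<sigma>" "?\<gamma> (length \<tau>) = \<tau>"
    using \<rho> by simp_all
  then have "\<sigma> \<in> range ?\<gamma>" "\<tau> \<in> range ?\<gamma>"
    using rangeI[of ?\<gamma> "length \<sigma>"] rangeI[of ?\<gamma> "length \<tau>"] by simp_all
  then show "below q \<sigma> \<tau>"
    using root_ray_through[OF assms(1,3)] assms \<rho> by (auto simp: below_def level_eq_length)
qed

lemma powr_neg_half: "q powr (- (real n / 2)) = (1 / sqrt q) ^ n" if "0 < q"
proof -
  have "q powr (- (real n / 2)) = (q powr (1/2)) powr (- real n)"
    by (simp add: powr_powr)
  also have "\<dots> = 1 / sqrt q powr real n"
    using that by (simp add: powr_half_sqrt powr_minus_divide)
  also have "\<dots> = (1 / sqrt q) ^ n"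
    using that by (simp add: powr_realpow power_one_over)
  finally show ?thesis .
qed

lemma tree_walk_reverse: "(tree_adj q ^^ n) \<sigma> \<tau> \<Longrightarrow> (tree_adj q ^^ n) \<tau> \<sigma>"
proof (induction n arbitrary: \<tau>)
  case (Suc n)
  then obtain \<upsilon> where walk: "(tree_adj q ^^ n) \<sigma> \<upsilon>" and step: "tree_adj q \<upsilon> \<tau>"
    by auto
  have "tree_adj q \<tau> \<upsilon>"
    using step by (auto simp: tree_adj_def)
  with Suc.IH[OF walk] show ?case
    by (rule relpowp_Suc_I2[rotated])
qed simp

lemma tree_dist_commute: "tree_dist q \<sigma> \<tau> = tree_dist q \<tau> \<sigma>"
proof -
  have "(tree_adj q ^^ n) \<sigma> \<tau> = (tree_adj q ^^ n) \<tau> \<sigma>" for n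
    using tree_walk_reverse by blast
  then show ?thesis
    by (simp only: tree_dist_def)
qed

lemma Gamma_kernel_descendant:
  assumes "0 < q" "\<tau> @ \<rho> \<in> tree q"
  shows "Gamma_kernel q f (\<tau> @ \<rho>) \<tau> =
      (1 / of_real (sqrt q)) ^ length \<rho> * fourier_coeff f (int (length \<rho>))" (is ?down)
    and "Gamma_kernel q f \<tau> (\<tau> @ \<rho>) =
      (1 / of_real (sqrt q)) ^ length \<rho> * fourier_coeff f (- int (length \<rho>))" (is ?up)
proof -
  have \<tau>: "\<tau> \<in> tree q"
    using assms(2) by (simp add: tree_append)
  then have "below q \<tau> (\<tau> @ \<rho>)"
    using below_iff_prefix assms by blast
  then have comp: "(\<tau> @ \<rho>, \<tau>) \<in> comparable q" "(\<tau>, \<tau> @ \<rho>) \<in> comparable q"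
    using \<tau> assms(2) by (simp_all add: comparable_def)
  have dist: "tree_dist q \<tau> (\<tau> @ \<rho>) = length \<rho>" "tree_dist q (\<tau> @ \<rho>) \<tau> = length \<rho>"
    using tree_dist_append[OF assms(2)] tree_dist_commute by metis+
  have pow: "of_real (real q powr (- (real n / 2))) = (1 / of_real (sqrt q) :: complex) ^ n" for n
    using powr_neg_half[of "real q" n] assms(1) by simp
  have lev: "level q \<tau> = length \<tau>" "level q (\<tau> @ \<rho>) = length \<tau> + length \<rho>"
    using level_eq_length[OF \<tau>] level_eq_length[OF assms(2)] by simp_all
  show ?down ?up
    unfolding Gamma_kernel_def dist pow lev using comp by simp_all
qed

lemma Gamma_kernel_incomparable:
  assumes "0 < q" "\<sigma> \<in> tree q" "\<tau> \<in> tree q"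
    and "\<nexists>\<rho>. \<tau> = \<sigma> @ \<rho>" "\<nexists>\<rho>. \<sigma> = \<tau> @ \<rho>"
  shows "Gamma_kernel q f \<sigma> \<tau> = 0"
proof -
  have "(\<sigma>, \<tau>) \<notin> comparable q"
    using below_iff_prefix[of q \<sigma> \<tau>] below_iff_prefix[of q \<tau> \<sigma>] assms
    unfolding comparable_def by blast
  then show ?thesis
    by (simp add: Gamma_kernel_def)
qed

section \<open>Bounded operators and their kernels\<close>

lemma ell2_summable: "x \<in> ell2 S \<Longrightarrow> (\<lambda>s. (cmod (x s))\<^sup>2) summable_on S"
  by (simp add: ell2_def)

lemma ell2_outside: "x \<in> ell2 S \<Longrightarrow> s \<notin> S \<Longrightarrow> x s = 0"
  by (simp add: ell2_def)

lemma ell2_finite_support: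
  assumes "finite F" "F \<subseteq> S" "\<And>s. s \<notin> F \<Longrightarrow> x s = 0"
  shows "x \<in> ell2 S"
proof -
  have "(\<lambda>s. (cmod (x s))\<^sup>2) summable_on S \<longleftrightarrow> (\<lambda>s. (cmod (x s))\<^sup>2) summable_on F"
    by (rule summable_on_cong_neutral) (use assms in auto)
  then show ?thesis
    using assms by (auto simp: ell2_def)
qed

lemma delta_in_ell2: "t \<in> S \<Longrightarrow> delta t \<in> ell2 S"
  by (rule ell2_finite_support[of "{t}"]) (auto simp: delta_def)

lemma ell2_lincomb:
  assumes "x \<in> ell2 S" "y \<in> ell2 S"
  shows "(\<lambda>s. a * x s + b * y s) \<in> ell2 S"
proof -
  have "(\<lambda>s. (2 * (cmod a)\<^sup>2) * (cmod (x s))\<^sup>2 + (2 * (cmod b)\<^sup>2) * (cmod (y s))\<^sup>2) summable_on S"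
    using assms by (intro summable_on_add summable_on_cmult_right ell2_summable)
  moreover have "(cmod (a * x s + b * y s))\<^sup>2
      \<le> (2 * (cmod a)\<^sup>2) * (cmod (x s))\<^sup>2 + (2 * (cmod b)\<^sup>2) * (cmod (y s))\<^sup>2" for s
  proof -
    have "(cmod (a * x s + b * y s))\<^sup>2 \<le> (cmod (a * x s) + cmod (b * y s))\<^sup>2"
      by (intro power_mono norm_triangle_ineq) simp
    also have "\<dots> \<le> 2 * (cmod (a * x s))\<^sup>2 + 2 * (cmod (b * y s))\<^sup>2"
      using sum_squares_bound[of "cmod (a * x s)" "cmod (b * y s)"] by (simp add: power2_sum)
    finally show ?thesis
      by (simp add: norm_mult power_mult_distrib)
  qed
  ultimately have "(\<lambda>s. (cmod (a * x s + b * y s))\<^sup>2) summable_on S"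
    by (rule summable_on_comparison_test) simp_all
  then show ?thesis
    using assms by (simp add: ell2_def)
qed

lemma ell2_prod_summable:
  assumes "(\<lambda>s. (cmod (x s))\<^sup>2) summable_on S" "(\<lambda>s. (cmod (y s))\<^sup>2) summable_on S"
  shows "(\<lambda>s. cmod (x s * y s)) summable_on S"
  by (rule abs_summable_product) (use assms in \<open>simp_all add: norm_mult power2_eq_square\<close>)

lemma ell2_norm_nonneg: "0 \<le> ell2_norm S x"
  by (simp add: ell2_norm_def infsum_nonneg)

lemma ell2_norm_square: "(ell2_norm S x)\<^sup>2 = (\<Sum>\<^sub>\<infinity>s\<in>S. (cmod (x s))\<^sup>2)"
  by (simp add: ell2_norm_def infsum_nonneg)

lemma ell2_inner_self: 
  assumes "x \<in> ell2 S"
  shows "ell2_inner S x x = of_real ((ell2_norm S x)\<^sup>2)"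
proof -
  have "((\<lambda>s. of_real ((cmod (x s))\<^sup>2) :: complex) has_sum of_real ((ell2_norm S x)\<^sup>2)) S"
    unfolding ell2_norm_square by (intro has_sum_of_real has_sum_infsum ell2_summable assms)
  then show ?thesis
    unfolding complex_norm_square ell2_inner_def by (rule infsumI)
qed

lemma cmod_le_ell2_norm:
  assumes "x \<in> ell2 S"
  shows "cmod (x s) \<le> ell2_norm S x"
proof (cases "s \<in> S")
  case True
  have "(\<Sum>s\<in>{s}. (cmod (x s))\<^sup>2) \<le> (\<Sum>\<^sub>\<infinity>s\<in>S. (cmod (x s))\<^sup>2)"
    by (rule finite_sum_le_infsum) (use True assms ell2_summable in auto)
  then have "(cmod (x s))\<^sup>2 \<le> (ell2_norm S x)\<^sup>2"
    by (simp add: ell2_norm_square)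
  then show ?thesis
    using ell2_norm_nonneg by (rule power2_le_imp_le)
qed (use assms in \<open>simp add: ell2_outside ell2_norm_nonneg\<close>)

text \<open>Density of the finitely supported vectors, in the form in which it is used to show that a kernel
  determines its operator.\<close>

lemma ell2_finite_truncation:
  assumes "x \<in> ell2 S" "0 < \<epsilon>"
  obtains F where "finite F" "F \<subseteq> S" "ell2_norm S (\<lambda>s. if s \<in> F then 0 else x s) < \<epsilon>"
proof -
  let ?g = "\<lambda>s. (cmod (x s))\<^sup>2"
  have sm: "?g summable_on S"
    using assms(1) by (rule ell2_summable)
  obtain F where F: "finite F" "F \<subseteq> S" "dist (sum ?g F) (infsum ?g S) \<le> \<epsilon>\<^sup>2 / 2"
    using infsum_finite_approximation[OF sm, of "\<epsilon>\<^sup>2 / 2"] assms(2) by auto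
  have "(ell2_norm S (\<lambda>s. if s \<in> F then 0 else x s))\<^sup>2 = infsum ?g (S - F)"
    unfolding ell2_norm_square by (rule infsum_cong_neutral) auto
  also have "\<dots> = infsum ?g S - sum ?g F"
    using F by (subst infsum_Diff) (use sm in auto)
  also have "\<dots> < \<epsilon>\<^sup>2"
  proof -
    have "\<bar>sum ?g F - infsum ?g S\<bar> \<le> \<epsilon>\<^sup>2 / 2" "0 < \<epsilon>\<^sup>2"
      using F(3) assms(2) by (simp_all only: dist_real_def zero_less_power)
    then show ?thesis by linarith
  qed
  finally have "ell2_norm S (\<lambda>s. if s \<in> F then 0 else x s) < \<epsilon>"
    by (rule power2_less_imp_less) (use assms(2) in simp)
  with F show ?thesis using that by blast
qed

lemma ell2_inner_delta: "s \<in> S \<Longrightarrow> ell2_inner S x (delta s) = x s"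
proof -
  assume s: "s \<in> S"
  have "ell2_inner S x (delta s) = (\<Sum>\<^sub>\<infinity>u\<in>{s}. x u * cnj (delta s u))"
    unfolding ell2_inner_def by (rule infsum_cong_neutral) (use s in \<open>auto simp: delta_def\<close>)
  then show ?thesis
    by (simp add: delta_def)
qed

lemma bounded_operator_linear:
  "bounded_operator S A \<Longrightarrow> x \<in> ell2 S \<Longrightarrow> y \<in> ell2 S \<Longrightarrow>
    A (\<lambda>s. a * x s + b * y s) = (\<lambda>s. a * A x s + b * A y s)"
  by (simp add: bounded_operator_def)

lemma bounded_operator_ell2: "bounded_operator S A \<Longrightarrow> x \<in> ell2 S \<Longrightarrow> A x \<in> ell2 S"
  by (auto simp: bounded_operator_def)

lemma bounded_operators_eq_finite_support:
  assumes A: "bounded_operator S A" and B: "bounded_operator S B"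
    and eq: "\<And>t. t \<in> S \<Longrightarrow> A (delta t) = B (delta t)"
    and F: "finite F" "F \<subseteq> S"
  shows "A (\<lambda>s. if s \<in> F then x s else 0) = B (\<lambda>s. if s \<in> F then x s else 0)"
  using F
proof (induction F)
  case empty
  have "(\<lambda>s. 0) \<in> ell2 S"
    by (rule ell2_finite_support[of "{}"]) auto
  from bounded_operator_linear[OF A this this, of 0 0] bounded_operator_linear[OF B this this, of 0 0]
  show ?case by simp
next
  case (insert t F)
  let ?x = "\<lambda>s. if s \<in> F then x s else 0"
  have mem: "?x \<in> ell2 S" "delta t \<in> ell2 S"
    using insert by (auto intro: ell2_finite_support[of F] delta_in_ell2)
  have split: "(\<lambda>s. if s \<in> insert t F then x s else 0) = (\<lambda>s. 1 * ?x s + x t * delta t s)"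
    using insert by (auto simp: delta_def)
  show ?case
    unfolding split bounded_operator_linear[OF A mem] bounded_operator_linear[OF B mem]
    using insert eq by simp
qed

lemma bounded_operators_eq:
  assumes A: "bounded_operator S A" and B: "bounded_operator S B"
    and eq: "\<And>t. t \<in> S \<Longrightarrow> A (delta t) = B (delta t)" and x: "x \<in> ell2 S"
  shows "A x = B x"
proof
  fix s
  obtain C where C: "\<And>y. y \<in> ell2 S \<Longrightarrow> ell2_norm S (A y) \<le> C * ell2_norm S y"
    using A unfolding bounded_operator_def by blast
  obtain D where D: "\<And>y. y \<in> ell2 S \<Longrightarrow> ell2_norm S (B y) \<le> D * ell2_norm S y"
    using B unfolding bounded_operator_def by blast
  have "cmod (A x s - B x s) \<le> e" if "0 < e" for e
  proof -
    (* The summand 1 keeps the denominator positive. *)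
    define \<epsilon> where "\<epsilon> = e / (\<bar>C\<bar> + \<bar>D\<bar> + 1)"
    have pos: "0 < \<epsilon>"
      using that by (simp add: \<epsilon>_def add_nonneg_pos)
    obtain F where F: "finite F" "F \<subseteq> S" "ell2_norm S (\<lambda>s. if s \<in> F then 0 else x s) < \<epsilon>"
      using ell2_finite_truncation[OF x pos] by blast
    let ?h = "\<lambda>s. if s \<in> F then x s else 0" and ?r = "\<lambda>s. if s \<in> F then 0 else x s"
    have h: "?h \<in> ell2 S"
      using F by (intro ell2_finite_support[of F]) auto
    have r_eq: "?r = (\<lambda>s. 1 * x s + (- 1) * ?h s)"
      by auto
    then have r: "?r \<in> ell2 S"
      using ell2_lincomb[OF x h, of 1 "- 1"] by simp
    have x_eq: "x = (\<lambda>s. 1 * ?h s + 1 * ?r s)"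
      by auto
    have "A x s - B x s = A ?r s - B ?r s"
      using bounded_operator_linear[OF A h r, of 1 1] bounded_operator_linear[OF B h r, of 1 1]
        bounded_operators_eq_finite_support[OF A B eq F(1,2), of x] x_eq
      by (simp add: fun_eq_iff)
    then have "cmod (A x s - B x s) \<le> cmod (A ?r s) + cmod (B ?r s)"
      by (simp add: norm_triangle_ineq4)
    also have "\<dots> \<le> ell2_norm S (A ?r) + ell2_norm S (B ?r)"
      by (intro add_mono cmod_le_ell2_norm bounded_operator_ell2[OF A r] bounded_operator_ell2[OF B r])
    also have "\<dots> \<le> \<bar>C\<bar> * ell2_norm S ?r + \<bar>D\<bar> * ell2_norm S ?r"
      using C[OF r] D[OF r] ell2_norm_nonneg[of S ?r]
      by (meson abs_ge_self add_mono mult_right_mono order_trans)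
    also have "\<dots> \<le> (\<bar>C\<bar> + \<bar>D\<bar> + 1) * ell2_norm S ?r"
      using ell2_norm_nonneg[of S ?r] by (simp add: algebra_simps)
    also have "\<dots> \<le> (\<bar>C\<bar> + \<bar>D\<bar> + 1) * \<epsilon>"
      using F(3) by (intro mult_left_mono) auto
    also have "\<dots> = e"
      by (simp add: \<epsilon>_def add_nonneg_eq_0_iff)
    finally show ?thesis .
  qed
  then have "cmod (A x s - B x s) \<le> 0"
    by (rule field_le_epsilon[of _ 0, simplified])
  then show "A x s = B x s" by simp
qed

lemma bounded_operator_restrict:
  assumes A: "bounded_operator S A"
  shows "bounded_operator S (restrict A (ell2 S))"
  unfolding bounded_operator_def
proof (intro conjI ballI allI)
  have restrict: "restrict A (ell2 S) x = A x" if "x \<in> ell2 S" for x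
    using that by simp
  show "restrict A (ell2 S) \<in> ell2 S \<rightarrow> ell2 S"
    using bounded_operator_ell2[OF A] by auto
  show "restrict A (ell2 S) (\<lambda>s. a * x s + b * y s) =
      (\<lambda>s. a * restrict A (ell2 S) x s + b * restrict A (ell2 S) y s)"
    if "x \<in> ell2 S" "y \<in> ell2 S" for x y a b
    unfolding restrict[OF that(1)] restrict[OF that(2)] restrict[OF ell2_lincomb[OF that]]
    by (rule bounded_operator_linear[OF A that])
  obtain C where "\<forall>x\<in>ell2 S. ell2_norm S (A x) \<le> C * ell2_norm S x"
    using A unfolding bounded_operator_def by blast
  then show "\<exists>C. \<forall>x\<in>ell2 S. ell2_norm S (restrict A (ell2 S) x) \<le> C * ell2_norm S x"
    using restrict by auto
qed

text \<open>To identify an operator given by a kernel it suffices to exhibit a bounded operator with the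
  right matrix coefficients: linearity determines it on finitely supported vectors and continuity
  on all others.\<close>

lemma operator_of_kernel_eq:
  assumes A: "bounded_operator S A"
    and K: "\<And>s t. s \<in> S \<Longrightarrow> t \<in> S \<Longrightarrow> A (delta t) s = K s t"
  shows "operator_of_kernel S K = restrict A (ell2 S)"
  unfolding operator_of_kernel_def
proof (rule the_equality)
  have "bounded_operator S (restrict A (ell2 S))"
    using A by (rule bounded_operator_restrict)
  moreover have "ell2_inner S (restrict A (ell2 S) (delta t)) (delta s) = K s t"
    if "s \<in> S" "t \<in> S" for s t
    using that K by (simp add: ell2_inner_delta delta_in_ell2)
  ultimately show "bounded_operator S (restrict A (ell2 S)) \<and> restrict A (ell2 S) \<in> extensional (ell2 S) \<and>
      (\<forall>s\<in>S. \<forall>t\<in>S. ell2_inner S (restrict A (ell2 S) (delta t)) (delta s) = K s t)"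
    by simp
next
  fix B
  assume B: "bounded_operator S B \<and> B \<in> extensional (ell2 S) \<and>
    (\<forall>s\<in>S. \<forall>t\<in>S. ell2_inner S (B (delta t)) (delta s) = K s t)"
  have "B (delta t) = A (delta t)" if t: "t \<in> S" for t
  proof
    fix s
    show "B (delta t) s = A (delta t) s"
    proof (cases "s \<in> S")
      case True
      then have "ell2_inner S (B (delta t)) (delta s) = K s t"
        using B t by blast
      then show ?thesis
        using True t K by (simp add: ell2_inner_delta)
    next
      case False
      then show ?thesis
        using B A t by (metis bounded_operator_ell2 delta_in_ell2 ell2_outside)
    qed
  qed
  then have eq: "B x = A x" if "x \<in> ell2 S" for x
    using bounded_operators_eq[of S B A x] B A that by blast
  show "B = restrict A (ell2 S)"
  proof (rule extensionalityI[where A = "ell2 S"])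
    show "B \<in> extensional (ell2 S)" "restrict A (ell2 S) \<in> extensional (ell2 S)"
      using B by simp_all
  qed (simp add: eq)
qed

text \<open>Testing the bound of a single row against the conjugate of that row gives
  \<open>s\<^sup>2 \<le> C * s\<close> for its partial square sums \<open>s\<close>.\<close>

lemma finite_sections_row_summable:
  fixes K :: "'a \<Rightarrow> 'a \<Rightarrow> complex"
  assumes bound: "\<And>F G x. finite F \<Longrightarrow> finite G \<Longrightarrow>
      (\<Sum>k\<in>G. (cmod (\<Sum>l\<in>F. K k l * x l))\<^sup>2) \<le> C * (\<Sum>l\<in>F. (cmod (x l))\<^sup>2)"
  shows "(\<lambda>l. (cmod (K k l))\<^sup>2) summable_on UNIV"
proof (rule nonneg_bdd_above_summable_on)
  show "bdd_above (sum (\<lambda>l. (cmod (K k l))\<^sup>2) ` {F. F \<subseteq> UNIV \<and> finite F})"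
  proof (rule bdd_aboveI2)
    fix F :: "'a set"
    assume F: "F \<in> {F. F \<subseteq> UNIV \<and> finite F}"
    let ?s = "\<Sum>l\<in>F. (cmod (K k l))\<^sup>2"
    have "0 \<le> ?s"
      by (simp add: sum_nonneg)
    moreover have "(\<Sum>l\<in>F. K k l * cnj (K k l)) = of_real ?s"
      by (simp only: complex_norm_square of_real_sum)
    ultimately have "cmod (\<Sum>l\<in>F. K k l * cnj (K k l)) = ?s"
      by (simp only: norm_of_real abs_of_nonneg)
    then have "?s\<^sup>2 \<le> C * ?s"
      using bound[of F "{k}" "\<lambda>l. cnj (K k l)"] F by simp
    moreover note \<open>0 \<le> ?s\<close>
    ultimately show "?s \<le> \<bar>C\<bar>"
      by (cases "?s = 0") (auto simp: power2_eq_square)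
  qed
qed simp

text \<open>A matrix whose finite sections are uniformly bounded defines a bounded operator. The rows are
  square summable, so the defining series converge, and the bound passes to the limit first in the
  columns and then in the rows.\<close>

lemma bounded_operator_of_finite_sections:
  fixes K :: "'a \<Rightarrow> 'a \<Rightarrow> complex"
  assumes bound: "\<And>F G x. finite F \<Longrightarrow> finite G \<Longrightarrow>
      (\<Sum>k\<in>G. (cmod (\<Sum>l\<in>F. K k l * x l))\<^sup>2) \<le> C * (\<Sum>l\<in>F. (cmod (x l))\<^sup>2)"
  shows "bounded_operator UNIV (\<lambda>x k. \<Sum>\<^sub>\<infinity>l. K k l * x l)"
proof -
  have row: "(\<lambda>l. (cmod (K k l))\<^sup>2) summable_on UNIV" for k
    by (rule finite_sections_row_summable) (rule bound)
  have summable: "(\<lambda>l. K k l * x l) summable_on UNIV" if "x \<in> ell2 UNIV" for k x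
    by (rule abs_summable_summable) (rule ell2_prod_summable[OF row ell2_summable[OF that]])
  define A where "A = (\<lambda>x k. \<Sum>\<^sub>\<infinity>l. K k l * x l)"
  have sections: "(\<Sum>k\<in>G. (cmod (A x k))\<^sup>2) \<le> C * (ell2_norm UNIV x)\<^sup>2"
    if x: "x \<in> ell2 UNIV" and G: "finite G" for x G
  proof (rule tendsto_le)
    show "((\<lambda>F. \<Sum>k\<in>G. (cmod (\<Sum>l\<in>F. K k l * x l))\<^sup>2) \<longlongrightarrow> (\<Sum>k\<in>G. (cmod (A x k))\<^sup>2))
        (finite_subsets_at_top UNIV)"
      unfolding A_def by (intro tendsto_intros infsum_tendsto summable x)
    show "((\<lambda>F. C * (\<Sum>l\<in>F. (cmod (x l))\<^sup>2)) \<longlongrightarrow> C * (ell2_norm UNIV x)\<^sup>2) (finite_subsets_at_top UNIV)"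
      unfolding ell2_norm_square by (intro tendsto_intros infsum_tendsto ell2_summable x)
    show "\<forall>\<^sub>F F in finite_subsets_at_top UNIV.
        (\<Sum>k\<in>G. (cmod (\<Sum>l\<in>F. K k l * x l))\<^sup>2) \<le> C * (\<Sum>l\<in>F. (cmod (x l))\<^sup>2)"
      by (rule eventually_finite_subsets_at_top_weakI) (use bound G in blast)
  qed simp
  have mem: "A x \<in> ell2 UNIV" if x: "x \<in> ell2 UNIV" for x
  proof -
    have "(\<lambda>k. (cmod (A x k))\<^sup>2) summable_on UNIV"
      by (rule nonneg_bdd_above_summable_on) (auto intro!: bdd_aboveI2 sections[OF x])
    then show ?thesis by (simp add: ell2_def)
  qed
  have "ell2_norm UNIV (A x) \<le> sqrt C * ell2_norm UNIV x" if x: "x \<in> ell2 UNIV" for x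
  proof -
    have "(ell2_norm UNIV (A x))\<^sup>2 \<le> C * (ell2_norm UNIV x)\<^sup>2"
      unfolding ell2_norm_square[of UNIV "A x"]
      by (rule infsum_le_finite_sums) (use ell2_summable[OF mem[OF x]] sections[OF x] in auto)
    then have "sqrt ((ell2_norm UNIV (A x))\<^sup>2) \<le> sqrt (C * (ell2_norm UNIV x)\<^sup>2)"
      by (rule real_sqrt_le_mono)
    then show ?thesis
      by (simp add: real_sqrt_mult ell2_norm_nonneg)
  qed
  moreover have "A (\<lambda>s. a * x s + b * y s) = (\<lambda>s. a * A x s + b * A y s)"
    if "x \<in> ell2 UNIV" "y \<in> ell2 UNIV" for x y a b
  proof
    fix k
    have "A (\<lambda>s. a * x s + b * y s) k = (\<Sum>\<^sub>\<infinity>l. a * (K k l * x l) + b * (K k l * y l))"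
      unfolding A_def by (simp add: algebra_simps)
    also have "\<dots> = a * A x k + b * A y k"
      unfolding A_def using summable[OF that(1)] summable[OF that(2)]
      by (simp add: infsum_add summable_on_cmult_right infsum_cmult_right)
    finally show "A (\<lambda>s. a * x s + b * y s) k = a * A x k + b * A y k" .
  qed
  ultimately have "bounded_operator UNIV A"
    using mem unfolding bounded_operator_def by blast
  then show ?thesis
    by (simp add: A_def)
qed

section \<open>Boundedness of Toeplitz operators\<close>

abbreviation circle_measure :: "real measure" where
  "circle_measure \<equiv> lebesgue_on {0..2*pi}"

lemma finite_circle_measure: "finite_measure circle_measure"
  by (rule finite_measureI) (simp add: emeasure_restrict_space)

lemma continuous_circle_measurable:
  fixes g :: "real \<Rightarrow> complex"
  assumes "continuous_on UNIV g"
  shows "g \<in> borel_measurable circle_measure"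
  using assms by (intro continuous_imp_measurable_on_sets_lebesgue) (auto intro: continuous_on_subset)

lemma bounded_circle_integrable:
  fixes g :: "real \<Rightarrow> 'a::{banach, second_countable_topology}"
  assumes "g \<in> borel_measurable circle_measure" "AE \<theta> in circle_measure. norm (g \<theta>) \<le> B"
  shows "integrable circle_measure g"
  by (rule finite_measure.integrable_const_bound[OF finite_circle_measure assms(2,1)])

text \<open>For \<open>n \<noteq> 0\<close> the primitive of the character is itself \<open>2\<pi>\<close>-periodic.\<close>

lemma integral_character:
  "(\<integral>\<theta>. cis (of_int n * \<theta>) \<partial>circle_measure) = (if n = 0 then of_real (2*pi) else 0)"
proof (cases "n = 0")
  case True
  then show ?thesis
    by (simp add: measure_restrict_space scaleR_conv_of_real)
next
  case False
  let ?G = "\<lambda>\<theta>. cis (of_int n * \<theta>) / (\<i> * of_int n)"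
  have "(?G has_vector_derivative cis (of_int n * \<theta>)) (at \<theta> within {0..2*pi})" for \<theta>
  proof -
    have "((\<lambda>z. exp (\<i> * (of_int n * z)) / (\<i> * of_int n)) has_field_derivative
        exp (\<i> * (of_int n * of_real \<theta>))) (at (of_real \<theta>))"
      using False by (auto intro!: derivative_eq_intros simp: mult_ac)
    from has_vector_derivative_real_field[OF this] show ?thesis
      by (simp add: cis_conv_exp)
  qed
  then have "((\<lambda>\<theta>. cis (of_int n * \<theta>)) has_integral ?G (2*pi) - ?G 0) {0..2*pi}"
    by (intro fundamental_theorem_of_calculus) simp_all
  moreover have "?G (2*pi) - ?G 0 = 0"
    using cis_multiple_2pi[of "of_int n"] by (simp add: mult.commute mult.left_commute)
  moreover have "integrable circle_measure (\<lambda>\<theta>. cis (of_int n * \<theta>))"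
    by (rule bounded_circle_integrable[where B = 1])
      (auto intro!: continuous_circle_measurable continuous_intros)
  then have "(\<integral>\<theta>. cis (of_int n * \<theta>) \<partial>circle_measure) = integral {0..2*pi} (\<lambda>\<theta>. cis (of_int n * \<theta>))"
    by (intro lebesgue_integral_eq_integral) simp_all
  ultimately show ?thesis
    using False by (simp add: integral_unique)
qed

definition trig_poly :: "nat set \<Rightarrow> (nat \<Rightarrow> complex) \<Rightarrow> real \<Rightarrow> complex" where
  "trig_poly F x \<theta> = (\<Sum>l\<in>F. x l * cis (of_nat l * \<theta>))"

lemma trig_poly_measurable: "trig_poly F x \<in> borel_measurable circle_measure"
  unfolding trig_poly_def by (intro continuous_circle_measurable continuous_intros)

lemma cmod_trig_poly_le: "cmod (trig_poly F x \<theta>) \<le> (\<Sum>l\<in>F. cmod (x l))"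
  unfolding trig_poly_def by (rule order_trans[OF norm_sum]) (simp add: norm_mult)

lemma trig_poly_square_integrable: "integrable circle_measure (\<lambda>\<theta>. (cmod (trig_poly F x \<theta>))\<^sup>2)"
  by (rule bounded_circle_integrable[where B = "(\<Sum>l\<in>F. cmod (x l))\<^sup>2"])
    (auto intro!: power_mono cmod_trig_poly_le trig_poly_measurable borel_measurable_power
      borel_measurable_norm measurable_compose[OF trig_poly_measurable])

lemma trig_poly_parseval:
  assumes "finite F"
  shows "(\<integral>\<theta>. (cmod (trig_poly F x \<theta>))\<^sup>2 \<partial>circle_measure) = 2 * pi * (\<Sum>l\<in>F. (cmod (x l))\<^sup>2)"
proof -
  have char_int: "integrable circle_measure (\<lambda>\<theta>. c * cis (of_int n * \<theta>))" for c n
    by (rule bounded_circle_integrable[where B = "cmod c"])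
      (auto intro!: continuous_circle_measurable continuous_intros simp: norm_mult)
  have "of_real (\<integral>\<theta>. (cmod (trig_poly F x \<theta>))\<^sup>2 \<partial>circle_measure) =
      (\<integral>\<theta>. complex_of_real ((cmod (trig_poly F x \<theta>))\<^sup>2) \<partial>circle_measure)"
    by (rule integral_complex_of_real[symmetric])
  also have "\<dots> = (\<integral>\<theta>. (\<Sum>l\<in>F. \<Sum>k\<in>F. x l * cnj (x k) * cis (of_int (int l - int k) * \<theta>)) \<partial>circle_measure)"
    unfolding complex_norm_square trig_poly_def cnj_sum sum_product
    by (simp add: cis_cnj cis_mult algebra_simps)
  also have "\<dots> = (\<Sum>l\<in>F. \<Sum>k\<in>F. x l * cnj (x k) * (\<integral>\<theta>. cis (of_int (int l - int k) * \<theta>) \<partial>circle_measure))"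
    using char_int by (simp add: integral_sum integrable_sum integral_mult_right_zero del: of_int_diff)
  also have "\<dots> = (\<Sum>l\<in>F. \<Sum>k\<in>F. if k = l then of_real (2 * pi * (cmod (x l))\<^sup>2) else 0)"
    unfolding integral_character of_real_mult complex_norm_square by (intro sum.cong refl) auto
  also have "\<dots> = of_real (2 * pi * (\<Sum>l\<in>F. (cmod (x l))\<^sup>2))"
    using assms by (simp add: sum_distrib_left)
  finally show ?thesis
    using of_real_eq_iff by blast
qed

text \<open>The Toeplitz matrix is the matrix of multiplication by \<open>f\<close> between trigonometric polynomials.\<close>

lemma toeplitz_form:
  assumes f: "f \<in> L_infinity_circle" and "finite F" "finite G"
  shows "(\<integral>\<theta>. f (cis \<theta>) * trig_poly F x \<theta> * cnj (trig_poly G y \<theta>) \<partial>circle_measure) =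
    2 * pi * (\<Sum>k\<in>G. (\<Sum>l\<in>F. Toeplitz_kernel f k l * x l) * cnj (y k))"
proof -
  obtain C where meas: "(\<lambda>\<theta>. f (cis \<theta>)) \<in> borel_measurable circle_measure"
    and C: "AE \<theta> in circle_measure. cmod (f (cis \<theta>)) \<le> C"
    using f by (auto simp: L_infinity_circle_def)
  have int: "integrable circle_measure (\<lambda>\<theta>. f (cis \<theta>) * cis (- (of_int n * \<theta>)))" for n
  proof (rule bounded_circle_integrable)
    show "AE \<theta> in circle_measure. norm (f (cis \<theta>) * cis (- (of_int n * \<theta>))) \<le> C"
      using C by (simp add: norm_mult)
    show "(\<lambda>\<theta>. f (cis \<theta>) * cis (- (of_int n * \<theta>))) \<in> borel_measurable circle_measure"
      by (intro borel_measurable_times meas continuous_circle_measurable continuous_intros)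
  qed
  have coeff: "(\<integral>\<theta>. f (cis \<theta>) * cis (- (of_int n * \<theta>)) \<partial>circle_measure) = 2 * pi * fourier_coeff f n" for n
    by (simp add: fourier_coeff_def)
  have "(\<integral>\<theta>. f (cis \<theta>) * trig_poly F x \<theta> * cnj (trig_poly G y \<theta>) \<partial>circle_measure) =
    (\<integral>\<theta>. (\<Sum>k\<in>G. \<Sum>l\<in>F. (x l * cnj (y k)) * (f (cis \<theta>) * cis (- (of_int (int k - int l) * \<theta>))))
      \<partial>circle_measure)"
  proof (rule Bochner_Integration.integral_cong[OF refl])
    fix \<theta>
    have "cis (real l * \<theta>) * cis (- (real k * \<theta>)) = cis (- (of_int (int k - int l) * \<theta>))" for k l
      by (simp add: cis_mult algebra_simps)
    then have "x l * cis (real l * \<theta>) * (cnj (y k) * cis (- (real k * \<theta>))) =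
        x l * cnj (y k) * cis (- (of_int (int k - int l) * \<theta>))" for k l
      by (metis (no_types, lifting) mult.assoc mult.left_commute)
    then have "trig_poly F x \<theta> * cnj (trig_poly G y \<theta>) =
        (\<Sum>l\<in>F. \<Sum>k\<in>G. x l * cnj (y k) * cis (- (of_int (int k - int l) * \<theta>)))"
      unfolding trig_poly_def cnj_sum sum_product complex_cnj_mult cis_cnj by (simp only:)
    then show "f (cis \<theta>) * trig_poly F x \<theta> * cnj (trig_poly G y \<theta>) =
      (\<Sum>k\<in>G. \<Sum>l\<in>F. (x l * cnj (y k)) * (f (cis \<theta>) * cis (- (of_int (int k - int l) * \<theta>))))"
      by (subst sum.swap) (simp add: mult.assoc sum_distrib_left mult.left_commute del: of_int_diff)
  qed
  also have "\<dots> = (\<Sum>k\<in>G. \<Sum>l\<in>F. (x l * cnj (y k)) * (2 * pi * fourier_coeff f (int k - int l)))"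
    using int coeff by (simp add: integral_sum integrable_sum integral_mult_right_zero del: of_int_diff)
  also have "\<dots> = 2 * pi * (\<Sum>k\<in>G. (\<Sum>l\<in>F. Toeplitz_kernel f k l * x l) * cnj (y k))"
    by (simp add: Toeplitz_kernel_def sum_distrib_left sum_distrib_right mult_ac)
  finally show ?thesis .
qed

text \<open>Let \<open>X\<close> be the polynomial with coefficients \<open>x\<close> and \<open>Y\<close> the one whose coefficients \<open>y\<close> are the
  entries of the section applied to \<open>x\<close>. Then \<open>\<parallel>y\<parallel>\<^sup>2\<close> is the mean of \<open>f X cnj Y\<close> over the circle, which
  by \<open>2 C |X| |Y| \<le> C\<^sup>2 |X|\<^sup>2 + |Y|\<^sup>2\<close> is at most \<open>(C\<^sup>2 \<parallel>x\<parallel>\<^sup>2 + \<parallel>y\<parallel>\<^sup>2) / 2\<close>; hence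
  \<open>\<parallel>y\<parallel>\<^sup>2 \<le> C\<^sup>2 \<parallel>x\<parallel>\<^sup>2\<close>.\<close>

lemma toeplitz_finite_sections:
  assumes f: "f \<in> L_infinity_circle"
  shows "\<exists>C. \<forall>F G x. finite F \<longrightarrow> finite G \<longrightarrow>
    (\<Sum>k\<in>G. (cmod (\<Sum>l\<in>F. Toeplitz_kernel f k l * x l))\<^sup>2) \<le> C * (\<Sum>l\<in>F. (cmod (x l))\<^sup>2)"
proof -
  obtain C where C: "AE \<theta> in circle_measure. cmod (f (cis \<theta>)) \<le> C"
    using f by (auto simp: L_infinity_circle_def)
  have "(\<Sum>k\<in>G. (cmod (\<Sum>l\<in>F. Toeplitz_kernel f k l * x l))\<^sup>2) \<le> C\<^sup>2 * (\<Sum>l\<in>F. (cmod (x l))\<^sup>2)"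
    if fin: "finite F" "finite G" for F G x
  proof -
    define y where "y k = (\<Sum>l\<in>F. Toeplitz_kernel f k l * x l)" for k
    let ?X = "trig_poly F x" and ?Y = "trig_poly G y"
    let ?sx = "\<Sum>l\<in>F. (cmod (x l))\<^sup>2" and ?sy = "\<Sum>k\<in>G. (cmod (y k))\<^sup>2"
    have "2 * pi * ?sy = cmod (\<integral>\<theta>. f (cis \<theta>) * ?X \<theta> * cnj (?Y \<theta>) \<partial>circle_measure)"
    proof -
      have "(\<integral>\<theta>. f (cis \<theta>) * ?X \<theta> * cnj (?Y \<theta>) \<partial>circle_measure) = of_real (2 * pi * ?sy)"
        unfolding toeplitz_form[OF f fin] y_def[symmetric] of_real_mult of_real_sum complex_norm_square
        by simp
      then show ?thesis
        by (simp only: norm_of_real) (simp add: sum_nonneg)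
    qed
    also have "\<dots> \<le> (\<integral>\<theta>. (C\<^sup>2 * (cmod (?X \<theta>))\<^sup>2 + (cmod (?Y \<theta>))\<^sup>2) / 2 \<partial>circle_measure)"
    proof -
      have pointwise: "cmod (f (cis \<theta>) * ?X \<theta> * cnj (?Y \<theta>)) \<le> (C\<^sup>2 * (cmod (?X \<theta>))\<^sup>2 + (cmod (?Y \<theta>))\<^sup>2) / 2"
        if "cmod (f (cis \<theta>)) \<le> C" for \<theta>
      proof -
        have "cmod (f (cis \<theta>) * ?X \<theta> * cnj (?Y \<theta>)) \<le> (C * cmod (?X \<theta>)) * cmod (?Y \<theta>)"
          using that by (auto simp: norm_mult intro!: mult_right_mono)
        also have "\<dots> \<le> ((C * cmod (?X \<theta>))\<^sup>2 + (cmod (?Y \<theta>))\<^sup>2) / 2"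
          using sum_squares_bound[of "C * cmod (?X \<theta>)" "cmod (?Y \<theta>)"] by simp
        finally show ?thesis by (simp add: power_mult_distrib)
      qed
      have bound: "AE \<theta> in circle_measure. cmod (f (cis \<theta>) * ?X \<theta> * cnj (?Y \<theta>))
          \<le> (C\<^sup>2 * (cmod (?X \<theta>))\<^sup>2 + (cmod (?Y \<theta>))\<^sup>2) / 2"
        using C by eventually_elim (rule pointwise)
      have major: "integrable circle_measure (\<lambda>\<theta>. (C\<^sup>2 * (cmod (?X \<theta>))\<^sup>2 + (cmod (?Y \<theta>))\<^sup>2) / 2)"
        using trig_poly_square_integrable by simp
      have "(\<lambda>\<theta>. f (cis \<theta>)) \<in> borel_measurable circle_measure"
        using f by (auto simp: L_infinity_circle_def)
      then have "(\<lambda>\<theta>. f (cis \<theta>) * ?X \<theta> * cnj (?Y \<theta>)) \<in> borel_measurable circle_measure"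
        by (intro borel_measurable_times trig_poly_measurable)
          (auto simp: trig_poly_def intro!: continuous_circle_measurable continuous_intros)
      then have "integrable circle_measure (\<lambda>\<theta>. f (cis \<theta>) * ?X \<theta> * cnj (?Y \<theta>))"
        by (rule Bochner_Integration.integrable_bound[OF major]) (use bound in \<open>eventually_elim, simp\<close>)
      then have "(\<integral>\<theta>. cmod (f (cis \<theta>) * ?X \<theta> * cnj (?Y \<theta>)) \<partial>circle_measure)
          \<le> (\<integral>\<theta>. (C\<^sup>2 * (cmod (?X \<theta>))\<^sup>2 + (cmod (?Y \<theta>))\<^sup>2) / 2 \<partial>circle_measure)"
        by (intro integral_mono_AE integrable_norm major bound)
      then show ?thesis
        by (rule order_trans[OF Bochner_Integration.integral_norm_bound])
    qed
    also have "\<dots> = (C\<^sup>2 * (2 * pi * ?sx) + 2 * pi * ?sy) / 2"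
      using trig_poly_square_integrable by (simp add: trig_poly_parseval fin)
    finally have "pi * ?sy \<le> pi * (C\<^sup>2 * ?sx)"
      by (simp add: algebra_simps)
    then show ?thesis
      by (simp add: y_def)
  qed
  then show ?thesis by blast
qed

lemma
  assumes "f \<in> L_infinity_circle"
  shows bounded_operator_Toeplitz: "bounded_operator UNIV (Toeplitz_operator f)"
    and Toeplitz_operator_apply:
      "x \<in> ell2 UNIV \<Longrightarrow> Toeplitz_operator f x = (\<lambda>k. \<Sum>\<^sub>\<infinity>l. Toeplitz_kernel f k l * x l)"
proof -
  obtain C where "\<And>F G x. finite F \<Longrightarrow> finite G \<Longrightarrow>
      (\<Sum>k\<in>G. (cmod (\<Sum>l\<in>F. Toeplitz_kernel f k l * x l))\<^sup>2) \<le> C * (\<Sum>l\<in>F. (cmod (x l))\<^sup>2)"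
    using toeplitz_finite_sections[OF assms] by blast
  then have bdd: "bounded_operator UNIV (\<lambda>x k. \<Sum>\<^sub>\<infinity>l. Toeplitz_kernel f k l * x l)"
    by (rule bounded_operator_of_finite_sections)
  have column: "(\<Sum>\<^sub>\<infinity>l. Toeplitz_kernel f k l * delta m l) = Toeplitz_kernel f k m" for k m
  proof -
    have "(\<Sum>\<^sub>\<infinity>l. Toeplitz_kernel f k l * delta m l) = (\<Sum>\<^sub>\<infinity>l\<in>{m}. Toeplitz_kernel f k l * delta m l)"
      by (rule infsum_cong_neutral) (auto simp: delta_def)
    then show ?thesis by (simp add: delta_def)
  qed
  have eq: "Toeplitz_operator f = restrict (\<lambda>x k. \<Sum>\<^sub>\<infinity>l. Toeplitz_kernel f k l * x l) (ell2 UNIV)"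
    unfolding Toeplitz_operator_def by (rule operator_of_kernel_eq[OF bdd column])
  show "bounded_operator UNIV (Toeplitz_operator f)"
    unfolding eq by (rule bounded_operator_restrict[OF bdd])
  show "Toeplitz_operator f x = (\<lambda>k. \<Sum>\<^sub>\<infinity>l. Toeplitz_kernel f k l * x l)" if "x \<in> ell2 UNIV"
    using that by (simp add: eq)
qed

section \<open>The shift on the tree and its Wold decomposition\<close>

text \<open>Row \<open>0\<close> of this unitary matrix is constant, so the zeroth coefficient of the values of a
  function at the children of a vertex is their normalised sum, and the other rows are an
  orthonormal basis of the vectors of sum zero.\<close>

definition dft :: "nat \<Rightarrow> nat \<Rightarrow> nat \<Rightarrow> complex" where
  "dft q j i = cis (2 * pi * real j * real i / real q) / of_real (sqrt q)"

lemma dft_0: "dft q 0 i = 1 / of_real (sqrt q)"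
  by (simp add: dft_def)

lemma dft_commute: "dft q j i = dft q i j"
  by (simp add: dft_def mult_ac)

lemma of_real_sqrt_mult_self: "of_real (sqrt (real q)) * of_real (sqrt (real q)) = (of_nat q :: complex)"
  by (metis abs_of_nat of_real_mult of_real_of_nat_eq real_sqrt_mult_self)

lemma dft_orthonormal:
  assumes "j < q" "k < q"
  shows "(\<Sum>i<q. dft q j i * cnj (dft q k i)) = (if j = k then 1 else 0)"
proof -
  define \<omega> where "\<omega> = cis (2 * pi * (real j - real k) / real q)"
  have q: "0 < real q"
    using assms by simp
  have "dft q j i * cnj (dft q k i) = \<omega> ^ i / of_nat q" for i
  proof -
    have "dft q j i * cnj (dft q k i) =
        cis (2 * pi * real j * real i / real q) * cis (- (2 * pi * real k * real i / real q)) /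
        (of_real (sqrt q) * of_real (sqrt q))"
      by (simp add: dft_def cis_cnj del: of_real_mult real_sqrt_mult_self)
    also have "\<dots> = cis (real i * (2 * pi * (real j - real k) / real q)) / of_nat q"
      unfolding of_real_sqrt_mult_self by (simp add: cis_mult algebra_simps diff_divide_distrib)
    also have "\<dots> = \<omega> ^ i / of_nat q"
      by (simp only: \<omega>_def Complex.DeMoivre)
    finally show ?thesis .
  qed
  then have sum: "(\<Sum>i<q. dft q j i * cnj (dft q k i)) = (\<Sum>i<q. \<omega> ^ i) / of_nat q"
    by (simp add: sum_divide_distrib)
  show ?thesis
  proof (cases "j = k")
    case True
    then have "\<omega> = 1" by (simp add: \<omega>_def)
    then show ?thesis using True sum q by simp
  next
    case False
    have "\<omega> \<noteq> 1"
    proof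
      assume "\<omega> = 1"
      then have "cos (2 * pi * (real j - real k) / real q) = 1"
        by (simp add: \<omega>_def complex_eq_iff)
      then obtain n :: int where "2 * pi * (real j - real k) / real q = n * 2 * pi"
        by (auto simp: cos_one_2pi_int)
      then have "2 * pi * (real j - real k) = 2 * pi * (n * real q)"
        using q by (simp add: nonzero_divide_eq_eq mult_ac)
      then have "real j - real k = n * real q"
        by (subst (asm) mult_cancel_left) simp
      then have "real_of_int (int j - int k) = real_of_int (n * int q)"
        by simp
      then have eq: "int j - int k = n * int q"
        using of_int_eq_iff by blast
      have "\<bar>int j - int k\<bar> < int q"
        using assms by linarith
      then have "\<bar>n\<bar> * int q < 1 * int q"
        unfolding eq by (simp add: abs_mult)
      then have "n = 0"
        by (simp only: mult_less_cancel_right) linarith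
      then show False
        using eq False by simp
    qed
    moreover have "\<omega> ^ q = 1"
    proof -
      have "\<omega> ^ q = cis (2 * pi * real_of_int (int j - int k))"
        using q by (simp add: \<omega>_def Complex.DeMoivre)
      then show ?thesis
        using cis_multiple_2pi[of "real_of_int (int j - int k)"] by simp
    qed
    ultimately show ?thesis
      using False sum by (simp add: sum_gp_strict)
  qed
qed

lemma dft_sum_eq_0:
  assumes "0 < j" "j < q"
  shows "(\<Sum>i<q. cnj (dft q j i)) = 0"
proof -
  have "1 / of_real (sqrt q) * (\<Sum>i<q. cnj (dft q j i)) = (\<Sum>i<q. dft q 0 i * cnj (dft q j i))"
    by (simp add: dft_0 sum_distrib_left)
  also have "\<dots> = 0"
    using dft_orthonormal[of 0 q j] assms by simp
  finally show ?thesis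
    using assms by simp
qed

lemma dft_parseval:
  "(\<Sum>j<q. (\<Sum>i<q. cnj (dft q j i) * u i) * cnj (\<Sum>i<q. cnj (dft q j i) * v i)) =
    (\<Sum>i<q. u i * cnj (v i))"
proof -
  have "(\<Sum>j<q. (\<Sum>i<q. cnj (dft q j i) * u i) * cnj (\<Sum>i<q. cnj (dft q j i) * v i)) =
      (\<Sum>j<q. \<Sum>i<q. \<Sum>k<q. u i * cnj (v k) * (dft q k j * cnj (dft q i j)))"
    by (simp add: sum_product dft_commute[of q _ _] mult_ac)
  also have "\<dots> = (\<Sum>i<q. \<Sum>k<q. \<Sum>j<q. u i * cnj (v k) * (dft q k j * cnj (dft q i j)))"
    by (subst sum.swap, rule sum.cong[OF refl], rule sum.swap)
  also have "\<dots> = (\<Sum>i<q. \<Sum>k<q. if k = i then u i * cnj (v i) else 0)"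
    by (intro sum.cong refl) (auto simp: sum_distrib_left[symmetric] dft_orthonormal)
  also have "\<dots> = (\<Sum>i<q. u i * cnj (v i))"
    by simp
  finally show ?thesis .
qed

text \<open>The isometry \<open>S\<close> that spreads the value at each vertex evenly over its children. The matrix
  coefficients of \<open>S ^^ n\<close> are \<open>q\<close> to the power \<open>- n / 2\<close> at pairs of a descendant and its
  ancestor \<open>n\<close> levels above, and zero elsewhere.\<close>

definition tree_shift :: "nat \<Rightarrow> (nat list \<Rightarrow> complex) \<Rightarrow> nat list \<Rightarrow> complex" where
  "tree_shift q x \<sigma> = (if \<sigma> = [] then 0 else x (butlast \<sigma>) / of_real (sqrt q))"

definition tree_shift_adj :: "nat \<Rightarrow> (nat list \<Rightarrow> complex) \<Rightarrow> nat list \<Rightarrow> complex" where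
  "tree_shift_adj q x \<sigma> = (\<Sum>i<q. x (\<sigma> @ [i])) / of_real (sqrt q)"

lemma tree_shift_adj_shift:
  assumes "0 < q"
  shows "tree_shift_adj q (tree_shift q x) = x"
proof
  fix \<sigma>
  have "tree_shift_adj q (tree_shift q x) \<sigma> = of_nat q * x \<sigma> / (of_real (sqrt q) * of_real (sqrt q))"
    by (simp add: tree_shift_adj_def tree_shift_def)
  then show "tree_shift_adj q (tree_shift q x) \<sigma> = x \<sigma>"
    using assms unfolding of_real_sqrt_mult_self by simp
qed

text \<open>The coefficients of \<open>x\<close> in the orthonormal basis of the Wold decomposition of \<open>S\<close>, indexed by
  vertices. For \<open>j > 0\<close> the entry at \<open>b @ [j]\<close> is the \<open>j\<close>-th Fourier coefficient of the values at
  the children of \<open>b\<close>; together with the entry at the root these are the coordinates of the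
  projection to the kernel of the adjoint of \<open>S\<close>. Each further \<open>0\<close> at the end of the word stands
  for one application of that adjoint before the coordinate is taken.\<close>

fun wold :: "nat \<Rightarrow> (nat list \<Rightarrow> complex) \<Rightarrow> nat list \<Rightarrow> complex" where
  "wold q x w =
     (if w = [] then x []
      else if last w = 0 then wold q (tree_shift_adj q x) (butlast w)
      else \<Sum>i<q. cnj (dft q (last w) i) * x (butlast w @ [i]))"

text \<open>The inverse of \<^const>\<open>wold\<close>: it reconstructs the values at the children of a vertex from their
  discrete Fourier coefficients, the zeroth of which comes from the coordinates at words ending
  in \<open>0\<close>.\<close>

fun unwold :: "nat \<Rightarrow> (nat list \<Rightarrow> complex) \<Rightarrow> nat list \<Rightarrow> complex" where
  "unwold q y \<sigma> =
     (if \<sigma> = [] then y []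
      else dft q 0 (last \<sigma>) * unwold q (\<lambda>w. y (w @ [0])) (butlast \<sigma>) +
        (\<Sum>j\<in>{0<..<q}. dft q j (last \<sigma>) * y (butlast \<sigma> @ [j])))"

declare wold.simps [simp del] unwold.simps [simp del]

lemma wold_Nil: "wold q x [] = x []"
  by (simp add: wold.simps)

lemma wold_snoc_0: "wold q x (w @ [0]) = wold q (tree_shift_adj q x) w"
  by (subst wold.simps) simp

lemma wold_snoc: "0 < j \<Longrightarrow> wold q x (w @ [j]) = (\<Sum>i<q. cnj (dft q j i) * x (w @ [i]))"
  by (subst wold.simps) simp

lemma unwold_Nil: "unwold q y [] = y []"
  by (simp add: unwold.simps)

lemma unwold_snoc: "unwold q y (\<sigma> @ [i]) = dft q 0 i * unwold q (\<lambda>w. y (w @ [0])) \<sigma> +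
    (\<Sum>j\<in>{0<..<q}. dft q j i * y (\<sigma> @ [j]))"
  by (subst unwold.simps) simp

definition sphere_at :: "nat \<Rightarrow> nat \<Rightarrow> nat list set" where
  "sphere_at q n = {\<sigma> \<in> tree q. length \<sigma> = n}"

lemma sphere_at_0: "sphere_at q 0 = {[]}"
  by (auto simp: sphere_at_def)

lemma finite_sphere_at: "finite (sphere_at q n)"
  unfolding sphere_at_def tree_def using finite_lists_length_eq[of "{..<q}" n] by simp

lemma sum_sphere_at_Suc:
  "(\<Sum>\<sigma>\<in>sphere_at q (Suc n). f \<sigma>) = (\<Sum>\<sigma>\<in>sphere_at q n. \<Sum>i<q. f (\<sigma> @ [i]))"
proof -
  have "bij_betw (\<lambda>(\<sigma>, i). \<sigma> @ [i]) (sphere_at q n \<times> {..<q}) (sphere_at q (Suc n))"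
  proof (rule bij_betwI')
    fix \<tau> assume \<tau>: "\<tau> \<in> sphere_at q (Suc n)"
    then have "\<tau> = butlast \<tau> @ [last \<tau>]"
      by (auto simp: sphere_at_def intro: append_butlast_last_id[symmetric])
    then obtain \<sigma> i where "\<tau> = \<sigma> @ [i]"
      by blast
    then show "\<exists>p\<in>sphere_at q n \<times> {..<q}. \<tau> = (case p of (\<sigma>, i) \<Rightarrow> \<sigma> @ [i])"
      using \<tau> by (auto simp: sphere_at_def)
  qed (auto simp: sphere_at_def)
  from sum.reindex_bij_betw[OF this, of f] show ?thesis
    by (simp add: sum.cartesian_product case_prod_unfold)
qed

text \<open>All steps of the recursion respect levels, so coefficients on level \<open>n\<close> depend on values on
  level \<open>n\<close> only, and the infinite-dimensional statements split into finite-dimensional ones.\<close>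

lemma wold_cong:
  assumes "w \<in> tree q" "\<And>\<sigma>. \<sigma> \<in> sphere_at q (length w) \<Longrightarrow> x \<sigma> = y \<sigma>"
  shows "wold q x w = wold q y w"
  using assms
proof (induction w arbitrary: x y rule: rev_induct)
  case Nil
  then show ?case by (simp add: wold_Nil sphere_at_0)
next
  case (snoc j w)
  have eq: "x (\<sigma> @ [i]) = y (\<sigma> @ [i])" if "\<sigma> \<in> sphere_at q (length w)" "i < q" for \<sigma> i
    using snoc.prems(2)[of "\<sigma> @ [i]"] that by (simp add: sphere_at_def)
  have w: "w \<in> tree q" "w \<in> sphere_at q (length w)"
    using snoc.prems(1) by (simp_all add: sphere_at_def)
  show ?case
  proof (cases "j = 0")
    case True
    have "wold q (tree_shift_adj q x) w = wold q (tree_shift_adj q y) w"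
      by (rule snoc.IH[OF w(1)]) (simp add: tree_shift_adj_def eq)
    then show ?thesis
      by (simp add: True wold_snoc_0)
  next
    case False
    then show ?thesis
      using eq[OF w(2)] by (simp add: wold_snoc)
  qed
qed

lemma wold_linear: "wold q (\<lambda>\<sigma>. a * x \<sigma> + b * y \<sigma>) w = a * wold q x w + b * wold q y w"
proof (induction w arbitrary: x y rule: rev_induct)
  case Nil
  show ?case by (simp add: wold_Nil)
next
  case (snoc j w)
  have "tree_shift_adj q (\<lambda>\<sigma>. a * x \<sigma> + b * y \<sigma>) =
      (\<lambda>\<sigma>. a * tree_shift_adj q x \<sigma> + b * tree_shift_adj q y \<sigma>)"
    by (simp add: tree_shift_adj_def fun_eq_iff sum.distrib sum_distrib_left add_divide_distrib)
  then show ?case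
    using snoc.IH[of "tree_shift_adj q x" "tree_shift_adj q y"]
    by (cases "j = 0") (simp_all add: wold_snoc_0 wold_snoc sum.distrib sum_distrib_left algebra_simps)
qed

text \<open>By Parseval at each vertex of level \<open>n\<close>, the inner product on level \<open>n + 1\<close> is the sum of the
  contributions of the coefficients with \<open>j > 0\<close> and of the zeroth ones. The latter form the vector
  \<^term>\<open>tree_shift_adj q x\<close> on level \<open>n\<close>, to which the induction hypothesis applies.\<close>

lemma wold_parseval:
  assumes "0 < q"
  shows "(\<Sum>w\<in>sphere_at q n. wold q x w * cnj (wold q y w)) = (\<Sum>\<sigma>\<in>sphere_at q n. x \<sigma> * cnj (y \<sigma>))"
proof (induction n arbitrary: x y)
  case 0
  show ?case by (simp add: sphere_at_0 wold_Nil)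
next
  case (Suc n)
  let ?D = "\<lambda>x w j. \<Sum>i<q. cnj (dft q j i) * x (w @ [i])"
  have split: "(\<Sum>j<q. g j) = g 0 + (\<Sum>j\<in>{0<..<q}. g j)" for g :: "nat \<Rightarrow> complex"
  proof -
    have "{..<q} = insert 0 {0<..<q}"
      using assms by auto
    then show ?thesis by simp
  qed
  have D0: "tree_shift_adj q x w = ?D x w 0" for x w
    by (simp add: tree_shift_adj_def dft_0 sum_divide_distrib)
  have "(\<Sum>j<q. wold q x (w @ [j]) * cnj (wold q y (w @ [j]))) =
      wold q (tree_shift_adj q x) w * cnj (wold q (tree_shift_adj q y) w) +
      (\<Sum>j\<in>{0<..<q}. ?D x w j * cnj (?D y w j))" for w
    by (subst split) (simp add: wold_snoc_0 wold_snoc del: cnj_sum)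
  then have "(\<Sum>w\<in>sphere_at q (Suc n). wold q x w * cnj (wold q y w)) =
      (\<Sum>w\<in>sphere_at q n. wold q (tree_shift_adj q x) w * cnj (wold q (tree_shift_adj q y) w)) +
      (\<Sum>w\<in>sphere_at q n. \<Sum>j\<in>{0<..<q}. ?D x w j * cnj (?D y w j))"
    by (simp only: sum_sphere_at_Suc sum.distrib)
  also have "\<dots> = (\<Sum>w\<in>sphere_at q n. ?D x w 0 * cnj (?D y w 0) + (\<Sum>j\<in>{0<..<q}. ?D x w j * cnj (?D y w j)))"
    unfolding Suc.IH by (simp only: D0 sum.distrib)
  also have "\<dots> = (\<Sum>w\<in>sphere_at q n. \<Sum>j<q. ?D x w j * cnj (?D y w j))"
    by (intro sum.cong refl split[symmetric])
  also have "\<dots> = (\<Sum>w\<in>sphere_at q n. \<Sum>i<q. x (w @ [i]) * cnj (y (w @ [i])))"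
    by (simp only: dft_parseval)
  finally show ?case
    by (simp only: sum_sphere_at_Suc)
qed

lemma wold_inj:
  assumes "0 < q" and eq: "\<And>w. w \<in> sphere_at q n \<Longrightarrow> wold q x w = wold q y w"
    and \<sigma>: "\<sigma> \<in> sphere_at q n"
  shows "x \<sigma> = y \<sigma>"
proof -
  define z where "z = (\<lambda>\<sigma>. 1 * x \<sigma> + (- 1) * y \<sigma>)"
  have "wold q z w = 0" if "w \<in> sphere_at q n" for w
    using eq[OF that] unfolding z_def wold_linear by simp
  then have "(\<Sum>\<sigma>\<in>sphere_at q n. z \<sigma> * cnj (z \<sigma>)) = 0"
    using wold_parseval[OF assms(1), where n = n and x = z and y = z] by simp
  then have "of_real (\<Sum>\<sigma>\<in>sphere_at q n. (cmod (z \<sigma>))\<^sup>2) = (0::complex)"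
    by (simp only: of_real_sum complex_norm_square)
  then have "(\<Sum>\<sigma>\<in>sphere_at q n. (cmod (z \<sigma>))\<^sup>2) = 0"
    using of_real_eq_0_iff by blast
  then have "(cmod (z \<sigma>))\<^sup>2 = 0"
    using \<sigma> finite_sphere_at by (subst (asm) sum_nonneg_eq_0_iff) auto
  then show ?thesis
    by (simp add: z_def)
qed

lemma wold_unwold:
  assumes "w \<in> tree q"
  shows "wold q (unwold q y) w = y w"
  using assms
proof (induction w arbitrary: y rule: rev_induct)
  case Nil
  show ?case by (simp add: wold_Nil unwold_Nil)
next
  case (snoc k w)
  then have q: "0 < q" and k: "k < q" and w: "w \<in> tree q"
    by auto
  (* The discrete Fourier coefficients that unwold prescribes for the children of \<sigma>. *)
  define Y where "Y \<sigma> j = (if j = 0 then unwold q (\<lambda>w. y (w @ [0])) \<sigma> else y (\<sigma> @ [j]))" for \<sigma> j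
  have split: "{..<q} = insert 0 {0<..<q}"
    using q by auto
  have unwold_Y: "unwold q y (\<sigma> @ [i]) = (\<Sum>j<q. dft q j i * Y \<sigma> j)" for \<sigma> i
    unfolding split by (simp add: unwold_snoc Y_def)
  have coeff: "(\<Sum>i<q. cnj (dft q j i) * unwold q y (\<sigma> @ [i])) = Y \<sigma> j" if "j < q" for \<sigma> j
  proof -
    have "(\<Sum>i<q. cnj (dft q j i) * unwold q y (\<sigma> @ [i])) =
        (\<Sum>i<q. \<Sum>l<q. Y \<sigma> l * (dft q l i * cnj (dft q j i)))"
      by (simp add: unwold_Y sum_distrib_left mult_ac)
    also have "\<dots> = (\<Sum>l<q. Y \<sigma> l * (\<Sum>i<q. dft q l i * cnj (dft q j i)))"
      by (subst sum.swap) (simp add: sum_distrib_left)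
    also have "\<dots> = (\<Sum>l<q. if l = j then Y \<sigma> j else 0)"
      using that by (intro sum.cong refl) (simp add: dft_orthonormal)
    also have "\<dots> = Y \<sigma> j"
      using that by simp
    finally show ?thesis .
  qed
  show ?case
  proof (cases "k = 0")
    case True
    have "tree_shift_adj q (unwold q y) \<sigma> = unwold q (\<lambda>w. y (w @ [0])) \<sigma>" for \<sigma>
    proof -
      have "tree_shift_adj q (unwold q y) \<sigma> = (\<Sum>i<q. cnj (dft q 0 i) * unwold q y (\<sigma> @ [i]))"
        by (simp add: tree_shift_adj_def dft_0 sum_divide_distrib)
      then show ?thesis
        using coeff[OF q] by (simp add: Y_def)
    qed
    then have "tree_shift_adj q (unwold q y) = unwold q (\<lambda>w. y (w @ [0]))"
      by (rule ext)
    then show ?thesis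
      using snoc.IH[OF w] True by (simp add: wold_snoc_0)
  next
    case False
    then show ?thesis
      using coeff[OF k] by (simp add: wold_snoc Y_def)
  qed
qed

text \<open>In Wold coordinates the adjoint of \<open>S\<close> is the backward shift along trailing zeros.\<close>

lemma wold_shift_adj_power:
  "wold q ((tree_shift_adj q ^^ d) x) w = wold q x (w @ replicate d 0)"
proof (induction d arbitrary: x)
  case (Suc d)
  have "wold q ((tree_shift_adj q ^^ Suc d) x) w = wold q (tree_shift_adj q x) (w @ replicate d 0)"
    unfolding funpow_Suc_right using Suc by simp
  also have "\<dots> = wold q x ((w @ replicate d 0) @ [0])"
    by (simp only: wold_snoc_0)
  finally show ?case
    by (simp add: replicate_append_same)
qed simp

lemma wold_shift_snoc_0:
  assumes "0 < q"
  shows "wold q (tree_shift q x) (w @ [0]) = wold q x w"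
  by (simp add: wold_snoc_0 tree_shift_adj_shift[OF assms])

text \<open>Words without trailing zeros; they index the copies of the unilateral shift.\<close>

definition primitive_words :: "nat \<Rightarrow> nat list set" where
  "primitive_words q = {b \<in> tree q. b = [] \<or> last b \<noteq> 0}"

lemma wold_shift_primitive:
  assumes "b \<in> primitive_words q"
  shows "wold q (tree_shift q x) b = 0"
proof (cases b rule: rev_cases)
  case Nil
  then show ?thesis by (simp add: wold_Nil tree_shift_def)
next
  case (snoc w j)
  then have "0 < j" "j < q"
    using assms by (auto simp: primitive_words_def)
  then show ?thesis
    using dft_sum_eq_0[of j q]
    by (simp add: snoc wold_snoc tree_shift_def sum_distrib_right[symmetric] sum_divide_distrib[symmetric])
qed

text \<open>In Wold coordinates \<open>S\<close> itself is the forward shift along trailing zeros: its range is orthogonal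
  to the kernel of the adjoint, which is where the coordinates at primitive words live, and at the
  other words one application of the adjoint cancels one of \<open>S\<close>.\<close>

lemma wold_shift_power:
  assumes "0 < q" "b \<in> primitive_words q"
  shows "wold q ((tree_shift q ^^ d) x) (b @ replicate n 0) =
    (if d \<le> n then wold q x (b @ replicate (n - d) 0) else 0)"
proof (induction d arbitrary: n)
  case (Suc d)
  show ?case
  proof (cases n)
    case 0
    then show ?thesis
      using wold_shift_primitive[OF assms(2)] by simp
  next
    case (Suc m)
    have "b @ replicate n 0 = (b @ replicate m 0) @ [0]"
      by (simp add: Suc replicate_append_same)
    then have "wold q ((tree_shift q ^^ Suc d) x) (b @ replicate n 0) =
        wold q ((tree_shift q ^^ d) x) (b @ replicate m 0)"
      by (simp only: funpow.simps comp_apply wold_shift_snoc_0[OF assms(1)])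
    then show ?thesis
      using Suc.IH[of m] Suc by simp
  qed
qed simp

lemma tree_shift_power_delta:
  "(tree_shift q ^^ d) (delta \<tau>) \<sigma> =
    (if \<exists>\<rho>. length \<rho> = d \<and> \<sigma> = \<tau> @ \<rho> then (1 / of_real (sqrt q)) ^ d else 0)"
proof (induction d arbitrary: \<sigma>)
  case 0
  show ?case by (simp add: delta_def)
next
  case (Suc d)
  show ?case
  proof (cases \<sigma> rule: rev_cases)
    case Nil
    then show ?thesis by (simp add: tree_shift_def)
  next
    case (snoc \<upsilon> i)
    have step: "(tree_shift q ^^ Suc d) (delta \<tau>) (\<upsilon> @ [i]) =
        (tree_shift q ^^ d) (delta \<tau>) \<upsilon> / of_real (sqrt q)"
      unfolding funpow.simps comp_apply by (subst tree_shift_def) simp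
    have shorten: "(\<exists>\<rho>. length \<rho> = Suc d \<and> \<upsilon> @ [i] = \<tau> @ \<rho>) \<longleftrightarrow> (\<exists>\<rho>. length \<rho> = d \<and> \<upsilon> = \<tau> @ \<rho>)"
    proof
      assume "\<exists>\<rho>. length \<rho> = Suc d \<and> \<upsilon> @ [i] = \<tau> @ \<rho>"
      then obtain \<rho> where \<rho>: "length \<rho> = Suc d" "\<upsilon> @ [i] = \<tau> @ \<rho>" by blast
      then obtain \<rho>' k where "\<rho> = \<rho>' @ [k]" "length \<rho>' = d"
        by (metis length_Suc_conv_rev)
      with \<rho> show "\<exists>\<rho>. length \<rho> = d \<and> \<upsilon> = \<tau> @ \<rho>"
        by auto
    next
      assume "\<exists>\<rho>. length \<rho> = d \<and> \<upsilon> = \<tau> @ \<rho>"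
      then obtain \<rho> where "length \<rho> = d" "\<upsilon> = \<tau> @ \<rho>" by blast
      then show "\<exists>\<rho>. length \<rho> = Suc d \<and> \<upsilon> @ [i] = \<tau> @ \<rho>"
        by (intro exI[of _ "\<rho> @ [i]"]) simp
    qed
    then show ?thesis
      unfolding snoc step shorten Suc.IH by auto
  qed
qed

lemma tree_shift_adj_power_delta:
  assumes "\<tau> \<in> tree q"
  shows "(tree_shift_adj q ^^ d) (delta \<tau>) \<sigma> =
    (if \<exists>\<rho>. length \<rho> = d \<and> \<tau> = \<sigma> @ \<rho> then (1 / of_real (sqrt q)) ^ d else 0)"
proof (induction d arbitrary: \<sigma>)
  case 0
  show ?case by (auto simp: delta_def)
next
  case (Suc d)
  have step: "(tree_shift_adj q ^^ Suc d) (delta \<tau>) \<sigma> =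
      (\<Sum>i<q. (tree_shift_adj q ^^ d) (delta \<tau>) (\<sigma> @ [i])) / of_real (sqrt q)"
    by (simp add: tree_shift_adj_def)
  show ?case
  proof (cases "\<exists>\<rho>. length \<rho> = Suc d \<and> \<tau> = \<sigma> @ \<rho>")
    case True
    then obtain k \<rho> where \<rho>: "length \<rho> = d" "\<tau> = \<sigma> @ k # \<rho>"
      by (metis length_Suc_conv)
    have "k < q"
      using assms \<rho> by (simp add: tree_def)
    have "(tree_shift_adj q ^^ d) (delta \<tau>) (\<sigma> @ [i]) =
        (if i = k then (1 / of_real (sqrt q)) ^ d else 0)" for i
      unfolding Suc.IH using \<rho> by auto
    then show ?thesis
      unfolding step using True \<open>k < q\<close> by simp
  next
    case False
    then have none: "\<not> (\<exists>\<rho>. length \<rho> = d \<and> \<tau> = (\<sigma> @ [i]) @ \<rho>)" for i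
      by (metis append.assoc append_Cons append_Nil length_Cons)
    then show ?thesis
      unfolding step Suc.IH by (simp only: none False if_False) simp
  qed
qed

section \<open>Words and the direct sum\<close>

lemma trailing_zeros_unique:
  assumes "b \<in> primitive_words q" "c \<in> primitive_words q" "b @ replicate m 0 = c @ replicate n 0"
  shows "b = c \<and> m = n"
  using assms
proof (induction m arbitrary: n)
  case 0
  show ?case
  proof (cases n)
    case (Suc k)
    then have "b = (c @ replicate k 0) @ [0]"
      using 0(3) by (simp add: replicate_append_same)
    then show ?thesis
      using 0(1) by (simp add: primitive_words_def)
  qed (use 0(3) in simp)
next
  case (Suc m)
  show ?case
  proof (cases n)
    case 0
    then have "c = (b @ replicate m 0) @ [0]"
      using Suc.prems(3) by (simp add: replicate_append_same)
    then show ?thesis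
      using Suc.prems(2) by (simp add: primitive_words_def)
  next
    case (Suc k)
    have "(b @ replicate m 0) @ [0] = (c @ replicate k 0) @ [0]"
      using Suc.prems(3) unfolding Suc by (simp add: replicate_append_same)
    then have "b @ replicate m 0 = c @ replicate k 0"
      by blast
    from Suc.IH[OF Suc.prems(1,2) this] show ?thesis
      using Suc by simp
  qed
qed

lemma trailing_zeros_exist:
  assumes "w \<in> tree q"
  shows "\<exists>b\<in>primitive_words q. \<exists>n. w = b @ replicate n 0"
  using assms
proof (induction w rule: rev_induct)
  case Nil
  then show ?case by (auto simp: primitive_words_def)
next
  case (snoc j w)
  show ?case
  proof (cases "j = 0")
    case True
    obtain b n where "b \<in> primitive_words q" "w = b @ replicate n 0"
      using snoc by auto
    then show ?thesis
      using True by (intro bexI[of _ b] exI[of _ "Suc n"]) (simp_all add: replicate_append_same)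
  next
    case False
    then have "w @ [j] \<in> primitive_words q"
      using snoc.prems by (simp add: primitive_words_def)
    then show ?thesis
      by (intro bexI[of _ "w @ [j]"] exI[of _ 0]) simp_all
  qed
qed

text \<open>For two or more children the words \<open>11\<dots>1\<close> give infinitely many primitive words; for a single
  child the empty word would be the only one.\<close>

lemma primitive_words_enumerable:
  assumes "2 \<le> q"
  shows "bij_betw (from_nat_into (primitive_words q)) UNIV (primitive_words q)"
proof -
  have "inj (\<lambda>n. replicate n (1::nat))"
    by (auto simp: inj_def dest: arg_cong[where f = length])
  moreover have "range (\<lambda>n. replicate n 1) \<subseteq> primitive_words q"
  proof -
    have "replicate n 1 \<in> primitive_words q" for n
      using assms by (cases "n = 0") (simp_all add: primitive_words_def tree_def)
    then show ?thesis
      by blast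
  qed
  ultimately have "infinite (primitive_words q)"
    using range_inj_infinite infinite_super by blast
  then show ?thesis
    by (intro bij_betw_from_nat_into) auto
qed

text \<open>Coordinate \<open>n\<close> of the \<open>k\<close>-th summand belongs to the \<open>k\<close>-th primitive word followed by \<open>n\<close>
  zeros.\<close>

definition word :: "nat \<Rightarrow> nat \<times> nat \<Rightarrow> nat list" where
  "word q = (\<lambda>(k, n). from_nat_into (primitive_words q) k @ replicate n 0)"

lemma bij_word:
  assumes "2 \<le> q"
  shows "bij_betw (word q) UNIV (tree q)"
proof -
  let ?b = "from_nat_into (primitive_words q)"
  have b: "bij_betw ?b UNIV (primitive_words q)"
    using assms by (rule primitive_words_enumerable)
  then have mem: "?b k \<in> primitive_words q" for k
    by (auto simp: bij_betw_def)
  show ?thesis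
  proof (rule bij_betwI')
    fix p p' :: "nat \<times> nat"
    show "word q p = word q p' \<longleftrightarrow> p = p'"
    proof
      assume "word q p = word q p'"
      then have "?b (fst p) = ?b (fst p') \<and> snd p = snd p'"
        unfolding word_def case_prod_unfold by (rule trailing_zeros_unique[OF mem mem])
      then show "p = p'"
        using injD[OF bij_betw_imp_inj_on[OF b]] by (simp add: prod_eq_iff)
    qed simp
  next
    fix p :: "nat \<times> nat"
    have "?b (fst p) \<in> tree q"
      using mem by (simp add: primitive_words_def)
    then show "word q p \<in> tree q"
      using assms by (simp add: word_def case_prod_unfold tree_append replicate_0_in_tree)
  next
    fix w assume "w \<in> tree q"
    then obtain c n where c: "c \<in> primitive_words q" "w = c @ replicate n 0"
      using trailing_zeros_exist by blast
    then obtain k where "c = ?b k"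
      using b by (auto simp: bij_betw_def)
    then show "\<exists>p\<in>UNIV. w = word q p"
      using c by (intro bexI[of _ "(k, n)"]) (simp_all add: word_def)
  qed
qed

lemma bij_levels: "bij_betw snd (Sigma UNIV (sphere_at q)) (tree q)"
proof (rule bij_betwI')
  fix \<sigma> assume "\<sigma> \<in> tree q"
  then show "\<exists>p\<in>Sigma UNIV (sphere_at q). \<sigma> = snd p"
    by (intro bexI[of _ "(length \<sigma>, \<sigma>)"]) (auto simp: sphere_at_def)
qed (auto simp: sphere_at_def)

lemma tree_summable_iff_levels:
  fixes f :: "nat list \<Rightarrow> real"
  assumes "\<And>\<sigma>. 0 \<le> f \<sigma>"
  shows "f summable_on tree q \<longleftrightarrow> (\<lambda>n. \<Sum>\<sigma>\<in>sphere_at q n. f \<sigma>) summable_on UNIV"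
proof -
  have "f summable_on tree q \<longleftrightarrow> (\<lambda>p. norm (f (snd p))) summable_on Sigma UNIV (sphere_at q)"
    using summable_on_reindex_bij_betw[OF bij_levels, of f q] assms by simp
  also have "\<dots> \<longleftrightarrow> (\<lambda>n. norm (\<Sum>\<^sub>\<infinity>\<sigma>\<in>sphere_at q n. norm (f \<sigma>))) summable_on UNIV"
    using Infinite_Sum.abs_summable_on_Sigma_iff[where f = "\<lambda>p. f (snd p)" and A = UNIV and B = "sphere_at q"] finite_sphere_at by simp
  also have "\<dots> \<longleftrightarrow> (\<lambda>n. \<Sum>\<sigma>\<in>sphere_at q n. f \<sigma>) summable_on UNIV"
    using finite_sphere_at assms by (simp add: sum_nonneg)
  finally show ?thesis .
qed

lemma tree_infsum_levels:
  fixes f :: "nat list \<Rightarrow> complex"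
  assumes "f summable_on tree q"
  shows "infsum f (tree q) = (\<Sum>\<^sub>\<infinity>n. \<Sum>\<sigma>\<in>sphere_at q n. f \<sigma>)"
proof -
  have "(\<lambda>p. f (snd p)) summable_on Sigma UNIV (sphere_at q)"
    using summable_on_reindex_bij_betw[OF bij_levels, of f q] assms by simp
  from infsum_Sigma_banach[OF this] show ?thesis
    using infsum_reindex_bij_betw[OF bij_levels, of f q] finite_sphere_at by simp
qed

lemma direct_sum_iff:
  "v \<in> direct_sum \<longleftrightarrow> (\<lambda>p. (cmod (v (fst p) (snd p)))\<^sup>2) summable_on UNIV"
proof -
  let ?f = "\<lambda>p. (cmod (v (fst p) (snd p)))\<^sup>2"
  have "?f summable_on UNIV \<longleftrightarrow> (\<lambda>p. norm (?f p)) summable_on (UNIV \<times> UNIV)"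
    by simp
  also have "\<dots> \<longleftrightarrow> v \<in> direct_sum"
    unfolding Infinite_Sum.abs_summable_on_Sigma_iff
    by (simp add: direct_sum_def ell2_def ell2_norm_square infsum_nonneg)
  finally show ?thesis by simp
qed

lemma direct_sum_inner_eq:
  assumes "v \<in> direct_sum" "w \<in> direct_sum"
  shows "direct_sum_inner v w = (\<Sum>\<^sub>\<infinity>p. v (fst p) (snd p) * cnj (w (fst p) (snd p)))"
proof -
  have "(\<lambda>p. cmod (v (fst p) (snd p) * cnj (w (fst p) (snd p)))) summable_on UNIV"
    using assms unfolding direct_sum_iff by (intro ell2_prod_summable) simp_all
  then have "(\<lambda>p. v (fst p) (snd p) * cnj (w (fst p) (snd p))) summable_on (UNIV \<times> UNIV)"
    by (simp add: abs_summable_summable)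
  from infsum_Sigma_banach[OF this] show ?thesis
    by (simp add: direct_sum_inner_def ell2_inner_def)
qed

definition wold_map :: "nat \<Rightarrow> (nat list \<Rightarrow> complex) \<Rightarrow> nat \<Rightarrow> nat \<Rightarrow> complex" where
  "wold_map q x = (\<lambda>k n. wold q x (word q (k, n)))"

lemma wold_summable_iff:
  assumes "0 < q"
  shows "(\<lambda>w. (cmod (wold q x w))\<^sup>2) summable_on tree q \<longleftrightarrow> (\<lambda>\<sigma>. (cmod (x \<sigma>))\<^sup>2) summable_on tree q"
proof -
  have "(\<Sum>w\<in>sphere_at q n. (cmod (wold q x w))\<^sup>2) = (\<Sum>\<sigma>\<in>sphere_at q n. (cmod (x \<sigma>))\<^sup>2)" for n
  proof -
    have "complex_of_real (\<Sum>w\<in>sphere_at q n. (cmod (wold q x w))\<^sup>2) =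
        of_real (\<Sum>\<sigma>\<in>sphere_at q n. (cmod (x \<sigma>))\<^sup>2)"
      unfolding of_real_sum complex_norm_square by (rule wold_parseval[OF assms])
    then show ?thesis
      using of_real_eq_iff by blast
  qed
  then show ?thesis
    by (simp add: tree_summable_iff_levels)
qed

lemma wold_map_in_direct_sum_iff:
  assumes "2 \<le> q"
  shows "wold_map q x \<in> direct_sum \<longleftrightarrow> (\<lambda>\<sigma>. (cmod (x \<sigma>))\<^sup>2) summable_on tree q"
proof -
  have "wold_map q x \<in> direct_sum \<longleftrightarrow> (\<lambda>p. (cmod (wold q x (word q p)))\<^sup>2) summable_on UNIV"
    by (simp add: direct_sum_iff wold_map_def)
  also have "\<dots> \<longleftrightarrow> (\<lambda>w. (cmod (wold q x w))\<^sup>2) summable_on tree q"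
    by (rule summable_on_reindex_bij_betw[OF bij_word[OF assms]])
  also have "\<dots> \<longleftrightarrow> (\<lambda>\<sigma>. (cmod (x \<sigma>))\<^sup>2) summable_on tree q"
    using assms by (intro wold_summable_iff) simp
  finally show ?thesis .
qed

lemma wold_map_inner:
  assumes "2 \<le> q" "x \<in> ell2 (tree q)" "y \<in> ell2 (tree q)"
  shows "direct_sum_inner (wold_map q x) (wold_map q y) = ell2_inner (tree q) x y"
proof -
  have q: "0 < q"
    using assms(1) by simp
  have ds: "wold_map q x \<in> direct_sum" "wold_map q y \<in> direct_sum"
    using assms by (simp_all add: wold_map_in_direct_sum_iff ell2_summable)
  have "direct_sum_inner (wold_map q x) (wold_map q y) =
      (\<Sum>\<^sub>\<infinity>p. wold q x (word q p) * cnj (wold q y (word q p)))"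
    unfolding direct_sum_inner_eq[OF ds] by (simp add: wold_map_def)
  also have "\<dots> = (\<Sum>\<^sub>\<infinity>w\<in>tree q. wold q x w * cnj (wold q y w))"
    by (rule infsum_reindex_bij_betw[OF bij_word[OF assms(1)]])
  also have "\<dots> = (\<Sum>\<^sub>\<infinity>n. \<Sum>w\<in>sphere_at q n. wold q x w * cnj (wold q y w))"
  proof (rule tree_infsum_levels, rule abs_summable_summable, rule ell2_prod_summable)
    show "(\<lambda>w. (cmod (wold q x w))\<^sup>2) summable_on tree q"
      unfolding wold_summable_iff[OF q] by (rule ell2_summable[OF assms(2)])
    show "(\<lambda>w. (cmod (cnj (wold q y w)))\<^sup>2) summable_on tree q"
      unfolding complex_mod_cnj wold_summable_iff[OF q] by (rule ell2_summable[OF assms(3)])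
  qed
  also have "\<dots> = (\<Sum>\<^sub>\<infinity>n. \<Sum>\<sigma>\<in>sphere_at q n. x \<sigma> * cnj (y \<sigma>))"
    by (simp only: wold_parseval[OF q])
  also have "\<dots> = (\<Sum>\<^sub>\<infinity>\<sigma>\<in>tree q. x \<sigma> * cnj (y \<sigma>))"
  proof (rule tree_infsum_levels[symmetric], rule abs_summable_summable, rule ell2_prod_summable)
    show "(\<lambda>\<sigma>. (cmod (x \<sigma>))\<^sup>2) summable_on tree q"
      by (rule ell2_summable[OF assms(2)])
    show "(\<lambda>\<sigma>. (cmod (cnj (y \<sigma>)))\<^sup>2) summable_on tree q"
      unfolding complex_mod_cnj by (rule ell2_summable[OF assms(3)])
  qed
  finally show ?thesis
    by (simp add: ell2_inner_def)
qed

lemma wold_map_linear: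
  "wold_map q (\<lambda>\<sigma>. a * x \<sigma> + b * y \<sigma>) = (\<lambda>k n. a * wold_map q x k n + b * wold_map q y k n)"
  by (simp add: wold_map_def wold_linear)

text \<open>The inverse is computed on each level by \<^const>\<open>unwold\<close>; square summability of the preimage
  is automatic because levelwise norms are preserved.\<close>

lemma wold_map_surj:
  assumes "2 \<le> q" "v \<in> direct_sum"
  shows "\<exists>x\<in>ell2 (tree q). wold_map q x = v"
proof -
  define y where "y w = case_prod v (inv (word q) w)" for w
  have inj: "inj (word q)" and word: "word q p \<in> tree q" for p
    using bij_word[OF assms(1)] by (auto simp: bij_betw_def)
  define x where "x \<sigma> = (if \<sigma> \<in> tree q then unwold q y \<sigma> else 0)" for \<sigma>
  have "wold q x w = y w" if "w \<in> tree q" for w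
  proof -
    have "wold q x w = wold q (unwold q y) w"
      using that by (rule wold_cong) (simp add: x_def sphere_at_def)
    then show ?thesis
      using that by (simp add: wold_unwold)
  qed
  then have "wold_map q x = v"
    using word by (simp add: wold_map_def y_def inv_f_f[OF inj])
  moreover from this have "x \<in> ell2 (tree q)"
    using assms wold_map_in_direct_sum_iff[OF assms(1), of x] by (simp add: ell2_def x_def)
  ultimately show ?thesis by blast
qed

lemma wold_map_inj:
  assumes "2 \<le> q" "wold_map q x = wold_map q y" "\<sigma> \<in> tree q"
  shows "x \<sigma> = y \<sigma>"
proof (rule wold_inj)
  show "0 < q" using assms(1) by simp
  show "\<sigma> \<in> sphere_at q (length \<sigma>)" using assms(3) by (simp add: sphere_at_def)
  fix w assume "w \<in> sphere_at q (length \<sigma>)"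
  then have "w \<in> range (word q)"
    using bij_word[OF assms(1)] by (auto simp: sphere_at_def bij_betw_def)
  then obtain k n where "w = word q (k, n)"
    by (auto simp: image_iff)
  then show "wold q x w = wold q y w"
    using fun_cong[OF fun_cong[OF assms(2), of k], of n] by (simp add: wold_map_def)
qed

section \<open>The unitary operator and the conjugated kernel\<close>

lemma unitary_wold_map:
  assumes "2 \<le> q"
  shows "unitary_to_direct_sum (tree q) (wold_map q)"
  unfolding unitary_to_direct_sum_def
proof (intro conjI ballI allI)
  show "bij_betw (wold_map q) (ell2 (tree q)) direct_sum"
    unfolding bij_betw_def
  proof
    show "inj_on (wold_map q) (ell2 (tree q))"
    proof (rule inj_onI, rule ext)
      fix x y \<sigma>
      assume "x \<in> ell2 (tree q)" "y \<in> ell2 (tree q)" "wold_map q x = wold_map q y"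
      then show "x \<sigma> = y \<sigma>"
        using wold_map_inj[OF assms, of x y \<sigma>] ell2_outside[of _ "tree q" \<sigma>] by metis
    qed
    have "wold_map q x \<in> direct_sum" if "x \<in> ell2 (tree q)" for x
      using that assms by (simp add: wold_map_in_direct_sum_iff ell2_summable)
    then show "wold_map q ` ell2 (tree q) = direct_sum"
      using wold_map_surj[OF assms] by blast
  qed
qed (simp_all add: wold_map_linear wold_map_inner assms)

lemma direct_sum_inner_self:
  assumes "v \<in> direct_sum"
  shows "direct_sum_inner v v = of_real (\<Sum>\<^sub>\<infinity>k. (ell2_norm UNIV (v k))\<^sup>2)"
proof -
  have "((\<lambda>k. complex_of_real ((ell2_norm UNIV (v k))\<^sup>2)) has_sum
      of_real (\<Sum>\<^sub>\<infinity>k. (ell2_norm UNIV (v k))\<^sup>2)) UNIV"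
    using assms by (intro has_sum_of_real has_sum_infsum) (simp add: direct_sum_def)
  then have "(\<Sum>\<^sub>\<infinity>k. complex_of_real ((ell2_norm UNIV (v k))\<^sup>2)) =
      of_real (\<Sum>\<^sub>\<infinity>k. (ell2_norm UNIV (v k))\<^sup>2)"
    by (rule infsumI)
  moreover have "ell2_inner UNIV (v k) (v k) = of_real ((ell2_norm UNIV (v k))\<^sup>2)" for k
    using assms by (intro ell2_inner_self) (simp add: direct_sum_def)
  ultimately show ?thesis
    by (simp only: direct_sum_inner_def)
qed

lemma direct_sum_op_bounded:
  assumes A: "bounded_operator UNIV A"
  shows "\<exists>C. \<forall>v\<in>direct_sum. direct_sum_op (\<lambda>k. A) v \<in> direct_sum \<and>
    (\<Sum>\<^sub>\<infinity>k. (ell2_norm UNIV (direct_sum_op (\<lambda>k. A) v k))\<^sup>2) \<le> C\<^sup>2 * (\<Sum>\<^sub>\<infinity>k. (ell2_norm UNIV (v k))\<^sup>2)"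
proof -
  obtain C where C: "\<And>x. x \<in> ell2 UNIV \<Longrightarrow> ell2_norm UNIV (A x) \<le> C * ell2_norm UNIV x"
    using A unfolding bounded_operator_def by blast
  show ?thesis
  proof (intro exI ballI)
    fix v assume v: "v \<in> direct_sum"
    then have mem: "v k \<in> ell2 UNIV" for k
      by (simp add: direct_sum_def)
    have sm: "(\<lambda>k. C\<^sup>2 * (ell2_norm UNIV (v k))\<^sup>2) summable_on UNIV"
      using v by (intro summable_on_cmult_right) (simp add: direct_sum_def)
    have le: "(ell2_norm UNIV (A (v k)))\<^sup>2 \<le> C\<^sup>2 * (ell2_norm UNIV (v k))\<^sup>2" for k
      using power_mono[OF C[OF mem] ell2_norm_nonneg, of k 2] by (simp add: power_mult_distrib)
    have sm': "(\<lambda>k. (ell2_norm UNIV (A (v k)))\<^sup>2) summable_on UNIV"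
      using sm le by (rule summable_on_comparison_test) simp
    have "(\<Sum>\<^sub>\<infinity>k. (ell2_norm UNIV (A (v k)))\<^sup>2) \<le> (\<Sum>\<^sub>\<infinity>k. C\<^sup>2 * (ell2_norm UNIV (v k))\<^sup>2)"
      by (rule infsum_mono[OF sm' sm le])
    then have "(\<Sum>\<^sub>\<infinity>k. (ell2_norm UNIV (A (v k)))\<^sup>2) \<le> C\<^sup>2 * (\<Sum>\<^sub>\<infinity>k. (ell2_norm UNIV (v k))\<^sup>2)"
      by (simp add: infsum_cmult_right')
    then show "direct_sum_op (\<lambda>k. A) v \<in> direct_sum \<and>
        (\<Sum>\<^sub>\<infinity>k. (ell2_norm UNIV (direct_sum_op (\<lambda>k. A) v k))\<^sup>2)
          \<le> C\<^sup>2 * (\<Sum>\<^sub>\<infinity>k. (ell2_norm UNIV (v k))\<^sup>2)"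
      using sm' bounded_operator_ell2[OF A mem] by (simp add: direct_sum_op_def direct_sum_def)
  qed
qed

lemma unitary_conjugate_bounded:
  assumes U: "unitary_to_direct_sum S U" and A: "bounded_operator UNIV A"
  shows "bounded_operator S (\<lambda>x. inv_into (ell2 S) U (direct_sum_op (\<lambda>k. A) (U x)))"
proof -
  define B where "B = (\<lambda>x. inv_into (ell2 S) U (direct_sum_op (\<lambda>k. A) (U x)))"
  have bij: "bij_betw U (ell2 S) direct_sum"
    and lin: "\<And>x y a b. x \<in> ell2 S \<Longrightarrow> y \<in> ell2 S \<Longrightarrow>
      U (\<lambda>s. a * x s + b * y s) = (\<lambda>k n. a * U x k n + b * U y k n)"
    and inner: "\<And>x y. x \<in> ell2 S \<Longrightarrow> y \<in> ell2 S \<Longrightarrow> direct_sum_inner (U x) (U y) = ell2_inner S x y"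
    using U unfolding unitary_to_direct_sum_def by blast+
  have Umem: "U x \<in> direct_sum" if "x \<in> ell2 S" for x
    using bij that by (auto simp: bij_betw_def)
  obtain C where opmem: "\<And>v. v \<in> direct_sum \<Longrightarrow> direct_sum_op (\<lambda>k. A) v \<in> direct_sum"
    and opbound: "\<And>v. v \<in> direct_sum \<Longrightarrow>
      (\<Sum>\<^sub>\<infinity>k. (ell2_norm UNIV (direct_sum_op (\<lambda>k. A) v k))\<^sup>2) \<le> C\<^sup>2 * (\<Sum>\<^sub>\<infinity>k. (ell2_norm UNIV (v k))\<^sup>2)"
    using direct_sum_op_bounded[OF A] by blast
  have Bmem: "B x \<in> ell2 S" if "x \<in> ell2 S" for x
    unfolding B_def using bij opmem[OF Umem[OF that]] by (metis bij_betw_def inv_into_into)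
  have UB: "U (B x) = direct_sum_op (\<lambda>k. A) (U x)" if "x \<in> ell2 S" for x
    unfolding B_def using bij opmem[OF Umem[OF that]] by (rule bij_betw_inv_into_right)
  have norm: "(ell2_norm S x)\<^sup>2 = (\<Sum>\<^sub>\<infinity>k. (ell2_norm UNIV (U x k))\<^sup>2)" if "x \<in> ell2 S" for x
  proof -
    have "complex_of_real ((ell2_norm S x)\<^sup>2) = of_real (\<Sum>\<^sub>\<infinity>k. (ell2_norm UNIV (U x k))\<^sup>2)"
      using inner[OF that that]
      by (simp only: direct_sum_inner_self[OF Umem[OF that]] ell2_inner_self[OF that])
    then show ?thesis
      using of_real_eq_iff by blast
  qed
  have "B (\<lambda>s. a * x s + b * y s) = (\<lambda>s. a * B x s + b * B y s)"
    if x: "x \<in> ell2 S" and y: "y \<in> ell2 S" for x y a b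
  proof -
    have comb: "(\<lambda>s. a * x s + b * y s) \<in> ell2 S" "(\<lambda>s. a * B x s + b * B y s) \<in> ell2 S"
      using x y Bmem by (simp_all add: ell2_lincomb)
    have comp: "U x k \<in> ell2 UNIV" "U y k \<in> ell2 UNIV" for k
      using Umem[OF x] Umem[OF y] by (simp_all add: direct_sum_def)
    have "U (B (\<lambda>s. a * x s + b * y s)) = direct_sum_op (\<lambda>k. A) (\<lambda>k n. a * U x k n + b * U y k n)"
      by (simp only: UB[OF comb(1)] lin[OF x y])
    also have "\<dots> = (\<lambda>k n. a * U (B x) k n + b * U (B y) k n)"
      unfolding UB[OF x] UB[OF y] direct_sum_op_def using bounded_operator_linear[OF A comp] by simp
    also have "\<dots> = U (\<lambda>s. a * B x s + b * B y s)"
      by (rule lin[OF Bmem[OF x] Bmem[OF y], symmetric])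
    finally show ?thesis
      using inj_onD[OF bij_betw_imp_inj_on[OF bij] _ Bmem[OF comb(1)] comb(2)] by blast
  qed
  moreover have "ell2_norm S (B x) \<le> \<bar>C\<bar> * ell2_norm S x" if x: "x \<in> ell2 S" for x
  proof -
    have "(ell2_norm S (B x))\<^sup>2 \<le> (\<bar>C\<bar> * ell2_norm S x)\<^sup>2"
      using opbound[OF Umem[OF x]]
      by (simp add: norm[OF Bmem[OF x]] norm[OF x] UB[OF x] power_mult_distrib)
    then show ?thesis
      by (rule power2_le_imp_le) (simp add: ell2_norm_nonneg)
  qed
  ultimately have "bounded_operator S B"
    using Bmem unfolding bounded_operator_def by blast
  then show ?thesis
    by (simp add: B_def)
qed

text \<open>The vector \<open>\<delta>\<^sub>\<tau>\<close> has Wold coefficients only on the level \<open>t\<close> of \<open>\<tau>\<close>, so at most one term of the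
  series survives, that of the \<open>l\<close> with \<open>|b| + l = t\<close>. On level \<open>s\<close> all the surviving matrix entries
  have the same index \<open>n - l = s - t\<close>, whatever the primitive word: between these two levels the
  direct sum of Toeplitz operators is a multiple of a power of the shift or of its adjoint.\<close>

lemma toeplitz_matrix_on_level:
  assumes q: "0 < q" and b: "b \<in> primitive_words q" and \<tau>: "\<tau> \<in> tree q"
    and s: "s = length b + n"
  shows "(\<Sum>\<^sub>\<infinity>l. Toeplitz_kernel f n l * wold q (delta \<tau>) (b @ replicate l 0)) =
    fourier_coeff f (int s - int (length \<tau>)) *
      (if s \<le> length \<tau> then wold q ((tree_shift_adj q ^^ (length \<tau> - s)) (delta \<tau>)) (b @ replicate n 0)
       else wold q ((tree_shift q ^^ (s - length \<tau>)) (delta \<tau>)) (b @ replicate n 0))"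
proof -
  have tree: "b @ replicate l 0 \<in> tree q" for l
    using b q by (simp add: primitive_words_def tree_append replicate_0_in_tree)
  have other: "wold q (delta \<tau>) (b @ replicate l 0) = 0" if "length b + l \<noteq> length \<tau>" for l
  proof -
    (* The zero function in the shape of wold_linear; on the level of this word it agrees with delta \<tau>. *)
    have "wold q (delta \<tau>) (b @ replicate l 0) = wold q (\<lambda>\<sigma>. 0 * delta \<tau> \<sigma> + 0 * delta \<tau> \<sigma>) (b @ replicate l 0)"
      by (rule wold_cong[OF tree]) (use that in \<open>auto simp: sphere_at_def delta_def\<close>)
    then show ?thesis
      unfolding wold_linear by simp
  qed
  show ?thesis
  proof (cases "length b \<le> length \<tau>")
    case True
    define m where "m = length \<tau> - length b"
    have "(\<Sum>\<^sub>\<infinity>l. Toeplitz_kernel f n l * wold q (delta \<tau>) (b @ replicate l 0)) =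
        (\<Sum>\<^sub>\<infinity>l\<in>{m}. Toeplitz_kernel f n l * wold q (delta \<tau>) (b @ replicate l 0))"
      by (rule infsum_cong_neutral) (use True in \<open>auto simp: m_def intro!: other\<close>)
    then have sum: "(\<Sum>\<^sub>\<infinity>l. Toeplitz_kernel f n l * wold q (delta \<tau>) (b @ replicate l 0)) =
        Toeplitz_kernel f n m * wold q (delta \<tau>) (b @ replicate m 0)"
      by simp
    have coeff: "Toeplitz_kernel f n m = fourier_coeff f (int s - int (length \<tau>))"
    proof -
      have "int n - int m = int s - int (length \<tau>)"
        using True by (simp add: s m_def)
      then show ?thesis
        by (simp only: Toeplitz_kernel_def)
    qed
    show ?thesis
    proof (cases "s \<le> length \<tau>")
      case True
      then have m: "m = n + (length \<tau> - s)"
        by (simp add: s m_def)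
      have "b @ replicate m 0 = (b @ replicate n 0) @ replicate (length \<tau> - s) 0"
        unfolding m by (simp only: replicate_add append_assoc)
      then show ?thesis
        using True by (simp only: sum coeff wold_shift_adj_power if_True)
    next
      case False
      then have "s - length \<tau> \<le> n" "n - (s - length \<tau>) = m"
        using \<open>length b \<le> length \<tau>\<close> by (simp_all add: s m_def)
      then show ?thesis
        using False by (simp add: sum coeff wold_shift_power[OF q b])
    qed
  next
    case False
    then have "(\<Sum>\<^sub>\<infinity>l. Toeplitz_kernel f n l * wold q (delta \<tau>) (b @ replicate l 0)) = 0"
      by (intro infsum_0) (simp add: other)
    moreover have "wold q ((tree_shift q ^^ (s - length \<tau>)) (delta \<tau>)) (b @ replicate n 0) = 0"
      using False by (simp add: wold_shift_power[OF q b] s)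
    ultimately show ?thesis
      using False by (simp add: s)
  qed
qed

text \<open>A power of \<open>S\<close> moves mass from a vertex to its descendants and a power of the adjoint moves it to
  an ancestor; the exponent prescribed by the two levels is the only one that can connect them.\<close>

lemma Gamma_kernel_eq_shift:
  assumes "0 < q" "\<sigma> \<in> tree q" "\<tau> \<in> tree q"
  shows "Gamma_kernel q f \<sigma> \<tau> = fourier_coeff f (int (length \<sigma>) - int (length \<tau>)) *
      (if length \<sigma> \<le> length \<tau> then (tree_shift_adj q ^^ (length \<tau> - length \<sigma>)) (delta \<tau>) \<sigma>
       else (tree_shift q ^^ (length \<sigma> - length \<tau>)) (delta \<tau>) \<sigma>)"
proof (cases "\<exists>\<rho>. \<tau> = \<sigma> @ \<rho>")
  case True
  then obtain \<rho> where "\<tau> = \<sigma> @ \<rho>" ..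
  then show ?thesis
    using Gamma_kernel_descendant(2)[of q \<sigma> \<rho> f] tree_shift_adj_power_delta[of \<tau> q "length \<rho>" \<sigma>] assms
    by simp
next
  case up: False
  show ?thesis
  proof (cases "\<exists>\<rho>. \<sigma> = \<tau> @ \<rho>")
    case True
    then obtain \<rho> where \<rho>: "\<sigma> = \<tau> @ \<rho>" ..
    then have "\<not> length \<sigma> \<le> length \<tau>"
      using up by auto
    then show ?thesis
      using Gamma_kernel_descendant(1)[of q \<tau> \<rho> f] tree_shift_power_delta[of "length \<rho>" q \<tau> \<sigma>] assms \<rho>
      by simp
  next
    case False
    have "Gamma_kernel q f \<sigma> \<tau> = 0"
      by (rule Gamma_kernel_incomparable[OF assms up False])
    then show ?thesis
      using up False by (simp add: tree_shift_power_delta tree_shift_adj_power_delta[OF assms(3)])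
  qed
qed

text \<open>The conjugated operator applied to \<open>\<delta>\<^sub>\<tau>\<close> and the candidate coming from the powers of \<open>S\<close> have
  the same Wold coefficients on the level of \<open>\<sigma>\<close>, hence the same value at \<open>\<sigma>\<close>.\<close>

lemma wold_conjugate_kernel:
  assumes q: "2 \<le> q" and f: "f \<in> L_infinity_circle" and \<sigma>: "\<sigma> \<in> tree q" and \<tau>: "\<tau> \<in> tree q"
  shows "inv_into (ell2 (tree q)) (wold_map q)
      (direct_sum_op (\<lambda>k. Toeplitz_operator f) (wold_map q (delta \<tau>))) \<sigma> = Gamma_kernel q f \<sigma> \<tau>"
proof -
  define v where "v = direct_sum_op (\<lambda>k. Toeplitz_operator f) (wold_map q (delta \<tau>))"
  define a where "a = inv_into (ell2 (tree q)) (wold_map q) v"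
  have q0: "0 < q"
    using q by simp
  have bij: "bij_betw (wold_map q) (ell2 (tree q)) direct_sum"
    using unitary_wold_map[OF q] by (simp add: unitary_to_direct_sum_def)
  have \<delta>: "wold_map q (delta \<tau>) \<in> direct_sum"
    using bij delta_in_ell2[OF \<tau>] by (auto simp: bij_betw_def)
  then have comp: "wold_map q (delta \<tau>) k \<in> ell2 UNIV" for k
    by (simp add: direct_sum_def)
  have "v \<in> direct_sum"
    unfolding v_def using direct_sum_op_bounded[OF bounded_operator_Toeplitz[OF f]] \<delta> by blast
  then have wold_a: "wold_map q a = v"
    unfolding a_def by (rule bij_betw_inv_into_right[OF bij])
  define s where "s = length \<sigma>"
  define d where "d = (if s \<le> length \<tau> then (tree_shift_adj q ^^ (length \<tau> - s)) (delta \<tau>)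
       else (tree_shift q ^^ (s - length \<tau>)) (delta \<tau>))"
  (* The zero multiple gives c the shape of the linear combination in wold_linear. *)
  define c where "c = (\<lambda>\<sigma>. fourier_coeff f (int s - int (length \<tau>)) * d \<sigma> + 0 * d \<sigma>)"
  have "a \<sigma> = c \<sigma>"
  proof (rule wold_inj[OF q0])
    show "\<sigma> \<in> sphere_at q s"
      using \<sigma> by (simp add: sphere_at_def s_def)
    fix w assume w: "w \<in> sphere_at q s"
    then have "w \<in> range (word q)"
      using bij_word[OF q] by (auto simp: sphere_at_def bij_betw_def)
    then obtain k n where kn: "w = word q (k, n)"
      by (auto simp: image_iff)
    define b where "b = from_nat_into (primitive_words q) k"
    have b: "b \<in> primitive_words q"
      using primitive_words_enumerable[OF q] by (auto simp: b_def bij_betw_def)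
    have w_eq: "w = b @ replicate n 0"
      by (simp add: kn word_def b_def)
    have "wold q a w = v k n"
      using fun_cong[OF fun_cong[OF wold_a, of k], of n] by (simp add: wold_map_def kn)
    also have "\<dots> = (\<Sum>\<^sub>\<infinity>l. Toeplitz_kernel f n l * wold q (delta \<tau>) (b @ replicate l 0))"
      unfolding v_def direct_sum_op_def Toeplitz_operator_apply[OF f comp]
      by (simp add: wold_map_def word_def b_def)
    also have "\<dots> = fourier_coeff f (int s - int (length \<tau>)) * wold q d w"
    proof -
      have len: "s = length b + n"
        using w by (auto simp: w_eq sphere_at_def)
      show ?thesis
        using toeplitz_matrix_on_level[OF q0 b \<tau> len, of f]
        by (cases "s \<le> length \<tau>") (simp_all only: w_eq d_def if_True if_False)
    qed
    also have "\<dots> = wold q c w"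
      unfolding c_def wold_linear by simp
    finally show "wold q a w = wold q c w" .
  qed
  then show ?thesis
    using Gamma_kernel_eq_shift[OF q0 \<sigma> \<tau>, of f]
    by (simp add: a_def v_def c_def d_def s_def)
qed

theorem theorem1p4:
  fixes q :: nat
  assumes "2 \<le> q"
  shows "\<exists>U. unitary_to_direct_sum (tree q) U \<and>
    (\<forall>f\<in>L_infinity_circle. \<forall>x\<in>ell2 (tree q).
       Gamma_operator q f x = inv_into (ell2 (tree q)) U (direct_sum_op (\<lambda>k. Toeplitz_operator f) (U x)))"
proof (intro exI conjI ballI)
  show U: "unitary_to_direct_sum (tree q) (wold_map q)"
    using assms by (rule unitary_wold_map)
  fix f x
  assume f: "f \<in> L_infinity_circle" and x: "x \<in> ell2 (tree q)"
  have "Gamma_operator q f = restrict (\<lambda>x. inv_into (ell2 (tree q)) (wold_map q)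
      (direct_sum_op (\<lambda>k. Toeplitz_operator f) (wold_map q x))) (ell2 (tree q))"
    unfolding Gamma_operator_def
    by (rule operator_of_kernel_eq[OF unitary_conjugate_bounded[OF U bounded_operator_Toeplitz[OF f]]])
      (rule wold_conjugate_kernel[OF assms f])
  then show "Gamma_operator q f x = inv_into (ell2 (tree q)) (wold_map q)
      (direct_sum_op (\<lambda>k. Toeplitz_operator f) (wold_map q x))"
    using x by simp
qed

end
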